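(* Let $n \geq 2$ and consider the store-and-forward packet routing problem on the uni-directional line network with $n$ nodes, uniform link capacity $c$ and uniform buffer size $B$, where $B, c \in [3, \log_2 n]$ are integers. There exists an online deterministic centralized packet-routing algorithm (which may reject and preempt packets) whose competitive ratio is $O(\log^5 n)$.
   Context: Store-and-forward packet routing model. The network is a directed graph $G=(V,E)$ with $n=|V|$ nodes. Every edge has capacity $c$: at most $c$ packets can traverse it in one time step, and traversing an edge takes one time step. Every node has a buffer that can store at most $B$ packets. Time is discrete and the network is synchronous. Each packet request is a 4-tuple $r_i=(a_i,b_i,t_i,d_i)$, where $a_i\in V$ is the source, $b_i\in V$ is the destination, $t_i\in\mathbb{N}$ is the time step at which the packet is input to $a_i$ via the node's local input (any number of packets may be input to a node in one time step), and $d_i$ is a deadline (possibly $\infty$). In each time step, each node considers the packets input locally, the packets arriving along incoming edges, and the packets stored in its buffer; packets whose destination is this node are removed from the network (delivered); among the remaining packets, the node decides which are forwarded along each outgoing edge (at most $c$ per edge), which are stored in its buffer (at most $B$), and deletes the rest. Deleting a locally input packet is called rejection; a packet that is not rejected is injected; deleting an injected packet before it reaches its destination is called preemption. The throughput of an algorithm on an input sequence $\sigma$ is the number of packets of $\sigma$ delivered to their destination no later than their deadline. An online algorithm receives no information about a request $r_i$ before time $t_i$; a centralized algorithm may base its decisions on all information revealed so far. A deterministic online algorithm ALG is $\rho$-competitive if for every input sequence $\sigma$, $|\mathrm{ALG}(\sigma)| \geq \frac{1}{\rho}|\mathrm{OPT}(\sigma)|$, where $|\mathrm{OPT}(\sigma)|$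 is the maximum throughput achievable on $\sigma$ (by an offline routing). The uni-directional line with $n$ nodes is the directed path $v_1\to v_2\to\cdots\to v_n$; requests satisfy that $b_i$ is $a_i$ or a node after $a_i$ on the path. *)

theory Defs
  imports Complex_Main "HOL-Library.Extended_Nat"
begin

text \<open>Store-and-forward routing on the uni-directional line with nodes 0,1,...,n-1
  (node v has the single outgoing edge v -> v+1).  A request is
  (source, destination, release time, deadline); the deadline may be infinity.\<close>

type_synonym request = "nat \<times> nat \<times> nat \<times> enat"

definition src :: "request \<Rightarrow> nat" where "src r = fst r"
definition dst :: "request \<Rightarrow> nat" where "dst r = fst (snd r)"
definition rel :: "request \<Rightarrow> nat" where "rel r = fst (snd (snd r))"
definition ddl :: "request \<Rightarrow> enat" where "ddl r = snd (snd (snd r))"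

text \<open>Valid input sequence for the line with n nodes: sources precede destinations,
  and requests are listed in order of their release times (the order in which
  an online algorithm learns about them).\<close>
definition valid_input :: "nat \<Rightarrow> request list \<Rightarrow> bool" where
  "valid_input n \<sigma> \<longleftrightarrow> (\<forall>r \<in> set \<sigma>. src r \<le> dst r \<and> dst r < n) \<and> sorted (map rel \<sigma>)"

datatype action = Forward | Keep | Delete

text \<open>A routing assigns to packet i and time step tau an action.
  loc \<sigma> A i tau = Some v: packet i is considered by node v in time step tau
  (locally input, arrived over the incoming edge, or stored in the buffer).\<close>
fun loc :: "request list \<Rightarrow> (nat \<Rightarrow> nat \<Rightarrow> action) \<Rightarrow> nat \<Rightarrow> nat \<Rightarrow> nat option" where
  "loc \<sigma> A i 0 = (if rel (\<sigma> ! i) = 0 then Some (src (\<sigma> ! i)) else None)"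
| "loc \<sigma> A i (Suc \<tau>) =
     (if rel (\<sigma> ! i) = Suc \<tau> then Some (src (\<sigma> ! i))
      else (case loc \<sigma> A i \<tau> of
              None \<Rightarrow> None
            | Some v \<Rightarrow> (if v = dst (\<sigma> ! i) then None
                         else (case A i \<tau> of
                                 Forward \<Rightarrow> Some (Suc v)
                               | Keep \<Rightarrow> Some v
                               | Delete \<Rightarrow> None))))"

definition feasible :: "nat \<Rightarrow> nat \<Rightarrow> request list \<Rightarrow> (nat \<Rightarrow> nat \<Rightarrow> action) \<Rightarrow> bool" where
  "feasible c B \<sigma> A \<longleftrightarrow>
     (\<forall>v \<tau>. card {i. i < length \<sigma> \<and> loc \<sigma> A i \<tau> = Some v \<and> v \<noteq> dst (\<sigma> ! i) \<and> A i \<tau> = Forward} \<le> c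
          \<and> card {i. i < length \<sigma> \<and> loc \<sigma> A i \<tau> = Some v \<and> v \<noteq> dst (\<sigma> ! i) \<and> A i \<tau> = Keep} \<le> B)"

definition delivered :: "request list \<Rightarrow> (nat \<Rightarrow> nat \<Rightarrow> action) \<Rightarrow> nat \<Rightarrow> bool" where
  "delivered \<sigma> A i \<longleftrightarrow> (\<exists>\<tau>. loc \<sigma> A i \<tau> = Some (dst (\<sigma> ! i)) \<and> enat \<tau> \<le> ddl (\<sigma> ! i))"

definition throughput :: "request list \<Rightarrow> (nat \<Rightarrow> nat \<Rightarrow> action) \<Rightarrow> nat" where
  "throughput \<sigma> A = card {i. i < length \<sigma> \<and> delivered \<sigma> A i}"

definition opt :: "nat \<Rightarrow> nat \<Rightarrow> request list \<Rightarrow> nat" where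
  "opt c B \<sigma> = Max {throughput \<sigma> A | A. feasible c B \<sigma> A}"

text \<open>A deterministic centralized algorithm maps the input sequence to a routing.
  It is online if its decision at time tau depends only on the requests
  revealed up to time tau.\<close>
type_synonym algorithm = "request list \<Rightarrow> nat \<Rightarrow> nat \<Rightarrow> action"

definition revealed :: "request list \<Rightarrow> nat \<Rightarrow> request list" where
  "revealed \<sigma> \<tau> = takeWhile (\<lambda>r. rel r \<le> \<tau>) \<sigma>"

definition online :: "nat \<Rightarrow> algorithm \<Rightarrow> bool" where
  "online n alg \<longleftrightarrow>
     (\<forall>\<sigma> \<sigma>' \<tau> i. valid_input n \<sigma> \<longrightarrow> valid_input n \<sigma>' \<longrightarrow>
        revealed \<sigma> \<tau> = revealed \<sigma>' \<tau> \<longrightarrow> i < length (revealed \<sigma> \<tau>) \<longrightarrow>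
        alg \<sigma> i \<tau> = alg \<sigma>' i \<tau>)"

end

theory Submission
  imports Defs "HOL-Library.Discrete_Functions"
begin

text \<open>
  In the coordinates (node \<open>x\<close>, row \<open>y = \<tau> + n - x\<close>) a packet traces a monotone path: forwarding
  keeps the row and storing keeps the node.  The plane is cut into \<open>K\<close> by \<open>K\<close> tiles with
  \<open>K = O(log\<^sup>2 n)\<close>.

  Near requests (short in \<open>x\<close>, or with almost no slack) travel straight along their row; in every
  row the packet with the nearest destination preempts the others, and since a feasible routing
  delivers only \<open>O(K log n)\<close> near packets of one row across a given edge, this loses a factor
  \<open>O(K log n)\<close>.

  Far requests are packed online by exponential weights into sketch paths on the grid of tiles,
  at most one per source tile.  The resources are not the edges but the dyadic keys of the maximal
  straight runs, each of which is granted only \<open>L = O(log n)\<close> times.  The level, the anchor modulo 4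
  and the position among the users of the key then give \<open>4 L\<^sup>2 = K\<close> colors such that runs sharing a
  tile have different colors, so that using the color as offset inside the tiles separates all
  accepted packets.  Any feasible routing has a sketch in which no key is used more than
  \<open>O(K log n)\<close> times; weak duality of the packing bounds the far packets.  Altogether the ratio is
  \<open>O(K log n) = O(log\<^sup>3 n)\<close>.
\<close>

section \<open>Trajectories\<close>

text \<open>A packet with an accepted sketch is never dropped, so its offsets must be fixed when it
  arrives, and each must stay the same along a whole run. Bounding only the edge loads would leave
  an online interval coloring problem. With keys each run is a single item, and the number of
  earlier users of its key, known at acceptance, can serve directly as part of a color. The price is
  the tile side \<open>K\<close>: accepted sketches are routed with constant capacity, whereas a
  feasible routing may push \<open>K * c\<close> packets over one side of a tile and
  \<open>K * B\<close> over the other.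

  Waiting times are unbounded, so a feasible packet may climb arbitrarily far, while levels below
  \<open>L\<close> allow only runs shorter than \<open>2 ^ L\<close>. Cutting every climb at a fixed
  height above its source could heap packets from many columns on one tile row; hence the cut
  depends on the column where the climb happens.

  The 3 for the buffers: a node stores at most one packet turning there and two packets still
  waiting at their source, whose source tiles lie in two consecutive tile rows.\<close>

definition wait_from :: "nat \<Rightarrow> nat \<Rightarrow> (nat \<Rightarrow> nat) \<Rightarrow> nat \<Rightarrow> nat" where
  "wait_from a y Y x = (if x = a then y else Y (x - 1))"

lemma loc_rel: "loc \<sigma> A i (rel (\<sigma> ! i)) = Some (src (\<sigma> ! i))"
  by (cases "rel (\<sigma> ! i)") auto

lemma loc_SucD:
  assumes "loc \<sigma> A i (Suc \<tau>) = Some v" "rel (\<sigma> ! i) \<noteq> Suc \<tau>"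
  obtains u where "loc \<sigma> A i \<tau> = Some u" "u \<noteq> dst (\<sigma> ! i)"
    "(A i \<tau> = Forward \<and> v = Suc u) \<or> (A i \<tau> = Keep \<and> v = u)"
  using assms by (auto split: if_splits option.splits action.splits)

lemma loc_ge:
  assumes "loc \<sigma> A i \<tau> = Some v"
  shows "rel (\<sigma> ! i) \<le> \<tau> \<and> src (\<sigma> ! i) \<le> v"
  using assms
proof (induction \<tau> arbitrary: v)
  case 0
  then show ?case by (simp split: if_splits)
next
  case (Suc \<tau>)
  show ?case
  proof (cases "rel (\<sigma> ! i) = Suc \<tau>")
    case True
    then show ?thesis using Suc.prems by simp
  next
    case False
    then obtain u where "loc \<sigma> A i \<tau> = Some u" "v = Suc u \<or> v = u"
      using loc_SucD[OF Suc.prems] by metis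
    then show ?thesis using Suc.IH[of u] by auto
  qed
qed

text \<open>Here \<open>T x\<close> is the step in which the packet is forwarded from
  \<open>x\<close>. Given \<open>\<lambda>x. Suc (T x)\<close>, the function
  \<open>wait_from\<close> yields the arrival step at \<open>x\<close>, since a link costs one step;
  in rows this one cancels, so there \<open>Y\<close> itself is passed.\<close>

lemma loc_crossing_times:
  assumes "loc \<sigma> A i \<tau> = Some v"
  shows "\<exists>T. wait_from (src (\<sigma> ! i)) (rel (\<sigma> ! i)) (\<lambda>x. Suc (T x)) v \<le> \<tau>
    \<and> (\<forall>\<theta>. wait_from (src (\<sigma> ! i)) (rel (\<sigma> ! i)) (\<lambda>x. Suc (T x)) v \<le> \<theta> \<and> \<theta> < \<tau>
          \<longrightarrow> loc \<sigma> A i \<theta> = Some v \<and> v \<noteq> dst (\<sigma> ! i) \<and> A i \<theta> = Keep)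
    \<and> (\<forall>x. src (\<sigma> ! i) \<le> x \<and> x < v \<longrightarrow>
          wait_from (src (\<sigma> ! i)) (rel (\<sigma> ! i)) (\<lambda>x. Suc (T x)) x \<le> T x \<and>
          loc \<sigma> A i (T x) = Some x \<and> x \<noteq> dst (\<sigma> ! i) \<and> A i (T x) = Forward \<and>
          (\<forall>\<theta>. wait_from (src (\<sigma> ! i)) (rel (\<sigma> ! i)) (\<lambda>x. Suc (T x)) x \<le> \<theta> \<and> \<theta> < T x
             \<longrightarrow> loc \<sigma> A i \<theta> = Some x \<and> A i \<theta> = Keep))"
  using assms
proof (induction \<tau> arbitrary: v)
  case 0
  then have "rel (\<sigma> ! i) = 0" "v = src (\<sigma> ! i)" by (auto split: if_splits)
  then show ?case by (intro exI[of _ "\<lambda>_. 0"]) (auto simp: wait_from_def)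
next
  case (Suc \<tau>)
  let ?a = "src (\<sigma> ! i)" and ?t = "rel (\<sigma> ! i)"
  show ?case
  proof (cases "?t = Suc \<tau>")
    case True
    then have "v = ?a" using Suc.prems by simp
    then show ?thesis using True by (intro exI[of _ "\<lambda>_. 0"]) (auto simp: wait_from_def)
  next
    case False
    then obtain u where u: "loc \<sigma> A i \<tau> = Some u" "u \<noteq> dst (\<sigma> ! i)"
      "(A i \<tau> = Forward \<and> v = Suc u) \<or> (A i \<tau> = Keep \<and> v = u)"
      using loc_SucD[OF Suc.prems] by metis
    obtain T where T: "wait_from ?a ?t (\<lambda>x. Suc (T x)) u \<le> \<tau>"
      "\<And>\<theta>. wait_from ?a ?t (\<lambda>x. Suc (T x)) u \<le> \<theta> \<and> \<theta> < \<tau> \<Longrightarrow> loc \<sigma> A i \<theta> = Some u \<and> u \<noteq> dst (\<sigma> ! i) \<and> A i \<theta> = Keep"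
      "\<And>x. ?a \<le> x \<and> x < u \<Longrightarrow> wait_from ?a ?t (\<lambda>x. Suc (T x)) x \<le> T x \<and>
          loc \<sigma> A i (T x) = Some x \<and> x \<noteq> dst (\<sigma> ! i) \<and> A i (T x) = Forward \<and>
          (\<forall>\<theta>. wait_from ?a ?t (\<lambda>x. Suc (T x)) x \<le> \<theta> \<and> \<theta> < T x \<longrightarrow> loc \<sigma> A i \<theta> = Some x \<and> A i \<theta> = Keep)"
      using Suc.IH[OF u(1)] by blast
    have au: "?a \<le> u" using loc_ge[OF u(1)] by simp
    from u(3) show ?thesis
    proof (elim disjE conjE)
      assume *: "A i \<tau> = Keep" "v = u"
      show ?thesis
        using T u(1,2) * by (intro exI[of _ T]) (auto simp: less_Suc_eq le_Suc_eq)
    next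
      assume *: "A i \<tau> = Forward" "v = Suc u"
      \<comment> \<open>Arrival steps at nodes up to \<open>u\<close> only read \<open>T\<close>
        before \<open>u\<close>, so this update leaves all earlier facts intact.\<close>
      let ?T = "T(u := \<tau>)"
      have w: "wait_from ?a ?t (\<lambda>x. Suc (?T x)) x = wait_from ?a ?t (\<lambda>x. Suc (T x)) x" if "?a \<le> x" "x \<le> u" for x
        using that by (auto simp: wait_from_def)
      show ?thesis
      proof (intro exI[of _ ?T] conjI allI impI)
        fix x assume "?a \<le> x \<and> x < v"
        then have x: "?a \<le> x" "x \<le> u" using * by auto
        show "wait_from ?a ?t (\<lambda>x. Suc (?T x)) x \<le> ?T x" using T(1,3) w[OF x] x by (cases "x = u") auto
        show "loc \<sigma> A i (?T x) = Some x" using T(3) x u by (cases "x = u") auto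
        show "x \<noteq> dst (\<sigma> ! i)" using T(3) x u by (cases "x = u") auto
        show "A i (?T x) = Forward" using T(3) x * by (cases "x = u") auto
        fix \<theta> assume "wait_from ?a ?t (\<lambda>x. Suc (?T x)) x \<le> \<theta> \<and> \<theta> < ?T x"
        then show "loc \<sigma> A i \<theta> = Some x" "A i \<theta> = Keep"
          using T(2)[of \<theta>] T(3)[of x] w[OF x] x by (cases "x = u"; auto)+
      qed (use * au in \<open>auto simp: wait_from_def\<close>)
    qed
  qed
qed

text \<open>Rows are numbered by \<open>y = \<tau> + n - x\<close>: forwarding keeps the row and storing increases it,
  so a packet's trajectory becomes a nondecreasing function \<open>Y\<close> giving the row in which it leaves
  each node \<open>x\<close>.  The shift by \<open>n\<close> keeps rows natural.\<close>

definition row0 :: "nat \<Rightarrow> request \<Rightarrow> nat" where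
  "row0 n r = rel r + n - src r"

text \<open>Link and buffer capacities become capacities of the horizontal and vertical edges of the
  grid. A packet waiting at \<open>x\<close> uses the vertical edges from its arrival row up to, but
  excluding, its exit row.\<close>

definition path_system ::
  "nat \<Rightarrow> nat \<Rightarrow> nat set \<Rightarrow> (nat \<Rightarrow> nat) \<Rightarrow> (nat \<Rightarrow> nat) \<Rightarrow> (nat \<Rightarrow> nat) \<Rightarrow> (nat \<Rightarrow> nat \<Rightarrow> nat) \<Rightarrow> bool" where
  "path_system c B I a b y Y \<longleftrightarrow> finite I
    \<and> (\<forall>i\<in>I. \<forall>x. a i \<le> x \<and> x < b i \<longrightarrow> wait_from (a i) (y i) (Y i) x \<le> Y i x)
    \<and> (\<forall>x h. card {i\<in>I. a i \<le> x \<and> x < b i \<and> Y i x = h} \<le> c)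
    \<and> (\<forall>x h. card {i\<in>I. a i \<le> x \<and> x < b i \<and> wait_from (a i) (y i) (Y i) x \<le> h \<and> h < Y i x} \<le> B)"

lemma feasible_path_system:
  assumes "valid_input n \<sigma>" "feasible c B \<sigma> A"
  obtains Y where
    "path_system c B {i. i < length \<sigma> \<and> delivered \<sigma> A i}
       (\<lambda>i. src (\<sigma> ! i)) (\<lambda>i. dst (\<sigma> ! i)) (\<lambda>i. row0 n (\<sigma> ! i)) Y"
    "\<And>i. i < length \<sigma> \<Longrightarrow> delivered \<sigma> A i \<Longrightarrow> src (\<sigma> ! i) < dst (\<sigma> ! i) \<Longrightarrow>
       enat (Y i (dst (\<sigma> ! i) - 1) + dst (\<sigma> ! i)) \<le> ddl (\<sigma> ! i) + enat n"
proof -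
  let ?I = "{i. i < length \<sigma> \<and> delivered \<sigma> A i}"
  let ?a = "\<lambda>i. src (\<sigma> ! i)" and ?b = "\<lambda>i. dst (\<sigma> ! i)" and ?t = "\<lambda>i. rel (\<sigma> ! i)"
  define P where "P i T \<longleftrightarrow> (?a i < ?b i \<longrightarrow> enat (Suc (T (?b i - 1))) \<le> ddl (\<sigma> ! i)) \<and>
     (\<forall>x. ?a i \<le> x \<and> x < ?b i \<longrightarrow>
          wait_from (?a i) (?t i) (\<lambda>x. Suc (T x)) x \<le> T x \<and>
          loc \<sigma> A i (T x) = Some x \<and> A i (T x) = Forward \<and>
          (\<forall>\<theta>. wait_from (?a i) (?t i) (\<lambda>x. Suc (T x)) x \<le> \<theta> \<and> \<theta> < T x
             \<longrightarrow> loc \<sigma> A i \<theta> = Some x \<and> A i \<theta> = Keep))" for i and T :: "nat \<Rightarrow> nat"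
  have "\<exists>T. P i T" if i: "i \<in> ?I" for i
  proof -
    from i obtain \<tau> where \<tau>: "loc \<sigma> A i \<tau> = Some (?b i)" "enat \<tau> \<le> ddl (\<sigma> ! i)"
      by (auto simp: delivered_def)
    obtain T where T: "wait_from (?a i) (?t i) (\<lambda>x. Suc (T x)) (?b i) \<le> \<tau>"
       "\<forall>x. ?a i \<le> x \<and> x < ?b i \<longrightarrow>
          wait_from (?a i) (?t i) (\<lambda>x. Suc (T x)) x \<le> T x \<and>
          loc \<sigma> A i (T x) = Some x \<and> A i (T x) = Forward \<and>
          (\<forall>\<theta>. wait_from (?a i) (?t i) (\<lambda>x. Suc (T x)) x \<le> \<theta> \<and> \<theta> < T x
             \<longrightarrow> loc \<sigma> A i \<theta> = Some x \<and> A i \<theta> = Keep)"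
      using loc_crossing_times[OF \<tau>(1)] by blast
    have "enat (Suc (T (?b i - 1))) \<le> ddl (\<sigma> ! i)" if "?a i < ?b i"
    proof -
      have "Suc (T (?b i - 1)) \<le> \<tau>" using T(1) that by (simp add: wait_from_def)
      then show ?thesis using \<tau>(2) by (meson enat_ord_simps(1) order_trans)
    qed
    with T(2) show ?thesis unfolding P_def by blast
  qed
  then have "\<forall>i\<in>?I. \<exists>T. P i T" by blast
  then obtain T where P: "\<forall>i\<in>?I. P i (T i)" by (rule bchoice[THEN exE])
  have T1: "enat (Suc (T i (?b i - 1))) \<le> ddl (\<sigma> ! i)" if "i \<in> ?I" "?a i < ?b i" for i
    using P that unfolding P_def by blast
  have T2: "wait_from (?a i) (?t i) (\<lambda>x. Suc (T i x)) x \<le> T i x \<and>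
          loc \<sigma> A i (T i x) = Some x \<and> A i (T i x) = Forward"
    if "i \<in> ?I" "?a i \<le> x" "x < ?b i" for i x
    using P that unfolding P_def by blast
  have T3: "loc \<sigma> A i \<theta> = Some x \<and> A i \<theta> = Keep"
    if "i \<in> ?I" "?a i \<le> x" "x < ?b i"
          "wait_from (?a i) (?t i) (\<lambda>x. Suc (T i x)) x \<le> \<theta>" "\<theta> < T i x" for i x \<theta>
    using P that unfolding P_def by blast
  define Y where "Y = (\<lambda>i x. T i x + n - x)"
  have bn: "?b i < n" if "i \<in> ?I" for i
    using assms(1) that by (simp add: valid_input_def)
  have wY: "wait_from (?a i) (row0 n (\<sigma> ! i)) (Y i) x = wait_from (?a i) (?t i) (\<lambda>x. Suc (T i x)) x + n - x"
    if "i \<in> ?I" "?a i \<le> x" for i x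
    using that by (auto simp: wait_from_def row0_def Y_def)
  show thesis
  proof
    show "path_system c B ?I ?a ?b (\<lambda>i. row0 n (\<sigma> ! i)) Y"
      unfolding path_system_def
    proof (intro conjI ballI allI impI)
      fix i x assume *: "i \<in> ?I" "?a i \<le> x \<and> x < ?b i"
      then show "wait_from (?a i) (row0 n (\<sigma> ! i)) (Y i) x \<le> Y i x"
        using wY T2 by (simp add: Y_def diff_le_mono)
    next
      fix x h
      \<comment> \<open>Row \<open>h\<close> at node \<open>x\<close> is time step
        \<open>h + x - n\<close>; the subtractions do not truncate because \<open>x < n\<close> on
        every trajectory.\<close>
      let ?F = "{i. i < length \<sigma> \<and> loc \<sigma> A i (h + x - n) = Some x \<and> x \<noteq> dst (\<sigma> ! i) \<and> A i (h + x - n) = Forward}"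
      have "{i\<in>?I. ?a i \<le> x \<and> x < ?b i \<and> Y i x = h} \<subseteq> ?F"
      proof
        fix i assume i: "i \<in> {i\<in>?I. ?a i \<le> x \<and> x < ?b i \<and> Y i x = h}"
        then have "T i x = h + x - n" using bn[of i] by (auto simp: Y_def)
        with i T2[of i x] show "i \<in> ?F" by auto
      qed
      then have "card {i\<in>?I. ?a i \<le> x \<and> x < ?b i \<and> Y i x = h} \<le> card ?F" by (rule card_mono[rotated]) auto
      also have "\<dots> \<le> c" using assms(2) by (simp add: feasible_def)
      finally show "card {i\<in>?I. ?a i \<le> x \<and> x < ?b i \<and> Y i x = h} \<le> c" .
    next
      fix x h
      let ?F = "{i. i < length \<sigma> \<and> loc \<sigma> A i (h + x - n) = Some x \<and> x \<noteq> dst (\<sigma> ! i) \<and> A i (h + x - n) = Keep}"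
      let ?G = "{i\<in>?I. ?a i \<le> x \<and> x < ?b i \<and> wait_from (?a i) (row0 n (\<sigma> ! i)) (Y i) x \<le> h \<and> h < Y i x}"
      have "?G \<subseteq> ?F"
      proof
        fix i assume i: "i \<in> ?G"
        then have i': "i \<in> ?I" "?a i \<le> x" "x < ?b i" by auto
        have "x < n" using bn[OF i'(1)] i' by auto
        then have "wait_from (?a i) (?t i) (\<lambda>x. Suc (T i x)) x \<le> h + x - n" "h + x - n < T i x"
          using i wY[of i x] i' by (auto simp: Y_def)
        with i T3[OF i'] show "i \<in> ?F" by auto
      qed
      then have "card ?G \<le> card ?F" by (rule card_mono[rotated]) auto
      also have "\<dots> \<le> B" using assms(2) by (simp add: feasible_def)
      finally show "card ?G \<le> B" .
    qed auto
  next
    fix i assume i: "i < length \<sigma>" "delivered \<sigma> A i" "?a i < ?b i"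
    have "Y i (?b i - 1) + ?b i = Suc (T i (?b i - 1)) + n"
      using bn[of i] i by (auto simp: Y_def)
    then show "enat (Y i (?b i - 1) + ?b i) \<le> ddl (\<sigma> ! i) + enat n"
      using T1[of i] i by (metis (mono_tags, lifting) add_right_mono mem_Collect_eq plus_enat_simps(1))
  qed
qed

text \<open>A converse of the extraction of times: the actions are prescribed by the clock alone,
  without reference to the position. This suffices because exit times increase strictly, so the only
  exit time met during the stay at \<open>v\<close> is \<open>T v\<close>.\<close>

lemma loc_follows_times:
  assumes "src (\<sigma> ! i) \<le> dst (\<sigma> ! i)"
    and T: "\<And>x. src (\<sigma> ! i) \<le> x \<Longrightarrow> x < dst (\<sigma> ! i) \<Longrightarrow> wait_from (src (\<sigma> ! i)) (rel (\<sigma> ! i)) (\<lambda>x. Suc (T x)) x \<le> T x"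
    and A: "\<And>\<tau>. A i \<tau> \<noteq> Delete"
    and F: "\<And>\<tau>. A i \<tau> = Forward \<longleftrightarrow> (\<exists>x. src (\<sigma> ! i) \<le> x \<and> x < dst (\<sigma> ! i) \<and> T x = \<tau>)"
  shows "loc \<sigma> A i \<tau> = Some v \<Longrightarrow> src (\<sigma> ! i) \<le> v \<and> v \<le> dst (\<sigma> ! i) \<and>
      wait_from (src (\<sigma> ! i)) (rel (\<sigma> ! i)) (\<lambda>x. Suc (T x)) v \<le> \<tau> \<and>
      (v < dst (\<sigma> ! i) \<longrightarrow> \<tau> \<le> T v \<and> (A i \<tau> = Forward \<longleftrightarrow> \<tau> = T v))" (is "_ \<Longrightarrow> ?P \<tau> v")
    and "loc \<sigma> A i (wait_from (src (\<sigma> ! i)) (rel (\<sigma> ! i)) (\<lambda>x. Suc (T x)) (dst (\<sigma> ! i))) = Some (dst (\<sigma> ! i))"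
proof -
  let ?a = "src (\<sigma> ! i)" and ?t = "rel (\<sigma> ! i)" and ?b = "dst (\<sigma> ! i)"
  have step: "T x < T (Suc x)" if "?a \<le> x" "Suc x < ?b" for x
    using T[of "Suc x"] that by (auto simp: wait_from_def split: if_splits)
  have strict: "T x < T x'" if "?a \<le> x" "x < x'" "x' < ?b" for x x'
    using that(2,1,3)
  proof (induction rule: less_Suc_induct)
    case (1 i) then show ?case using step by auto
  next
    case (2 i j k) then show ?case by (meson le_less_trans less_imp_le less_trans)
  qed
  have fw: "A i \<tau> = Forward \<longleftrightarrow> \<tau> = T v" if "?a \<le> v" "v < ?b" "wait_from ?a ?t (\<lambda>x. Suc (T x)) v \<le> \<tau>" "\<tau> \<le> T v" for v \<tau>
  proof
    assume "A i \<tau> = Forward"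
    then obtain x where x: "?a \<le> x" "x < ?b" "T x = \<tau>" using F by auto
    show "\<tau> = T v"
    proof (cases x v rule: linorder_cases)
      case less
      have "x = v - 1 \<or> x < v - 1" "v - 1 < ?b" using less that(2) by linarith+
      then have "T x \<le> T (v - 1)" using strict[of x "v - 1"] that x by auto
      then show ?thesis using that(3) less x by (auto simp: wait_from_def split: if_splits)
    next
      case greater
      then show ?thesis using strict[of v x] that x by auto
    qed (use x in auto)
  qed (use F that in auto)
  have main: "?P \<tau> v" if "loc \<sigma> A i \<tau> = Some v" for \<tau> v
    using that
  proof (induction \<tau> arbitrary: v)
    case 0
    then have "?t = 0" "v = ?a" by (auto split: if_splits)
    then show ?case using assms(1) fw[of v 0] by (auto simp: wait_from_def)
  next
    case (Suc \<tau>)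
    show ?case
    proof (cases "?t = Suc \<tau>")
      case True
      then have "v = ?a" using Suc.prems by simp
      then show ?thesis using True assms(1) T[of ?a] fw[of ?a "Suc \<tau>"] by (auto simp: wait_from_def)
    next
      case False
      then obtain u where u: "loc \<sigma> A i \<tau> = Some u" "u \<noteq> ?b"
        "(A i \<tau> = Forward \<and> v = Suc u) \<or> (A i \<tau> = Keep \<and> v = u)"
        using loc_SucD[OF Suc.prems] by metis
      have IH: "?a \<le> u" "u < ?b" "wait_from ?a ?t (\<lambda>x. Suc (T x)) u \<le> \<tau>" "\<tau> \<le> T u"
        "A i \<tau> = Forward \<longleftrightarrow> \<tau> = T u"
        using Suc.IH[OF u(1)] u(2) by auto
      from u(3) show ?thesis
      proof (elim disjE conjE)
        assume "A i \<tau> = Keep" "v = u"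
        then show ?thesis using IH fw[of u "Suc \<tau>"] by auto
      next
        assume "A i \<tau> = Forward" and v: "v = Suc u"
        then have \<tau>: "\<tau> = T u" using IH by simp
        have w: "wait_from ?a ?t (\<lambda>x. Suc (T x)) v \<le> Suc \<tau>" using \<tau> v IH(1) by (auto simp: wait_from_def)
        show ?thesis using w v IH \<tau> step[of u] fw[of v "Suc \<tau>"] by auto
      qed
    qed
  qed
  then show "loc \<sigma> A i \<tau> = Some v \<Longrightarrow> ?P \<tau> v" .
  have wait: "loc \<sigma> A i \<tau> = Some x"
    if "?a \<le> x" "x < ?b" "loc \<sigma> A i (wait_from ?a ?t (\<lambda>x. Suc (T x)) x) = Some x"
      "wait_from ?a ?t (\<lambda>x. Suc (T x)) x \<le> \<tau>" "\<tau> \<le> T x" for x \<tau>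
    using that(4,5)
  proof (induction rule: dec_induct)
    case base then show ?case using that(3) by simp
  next
    case (step \<tau>)
    then have l: "loc \<sigma> A i \<tau> = Some x" by simp
    have "A i \<tau> = Keep" using fw[of x \<tau>] that step A[of \<tau>] by (cases "A i \<tau>") auto
    then show ?case using l that(2) loc_ge[OF l] by simp
  qed
  have arr: "x \<le> ?b \<Longrightarrow> loc \<sigma> A i (wait_from ?a ?t (\<lambda>x. Suc (T x)) x) = Some x" if "?a \<le> x" for x
    using that
  proof (induction rule: dec_induct)
    case base then show ?case by (simp add: wait_from_def loc_rel)
  next
    case (step x)
    have l: "loc \<sigma> A i (T x) = Some x" using wait[of x "T x"] T[of x] step by auto
    have "A i (T x) = Forward" using F step by auto
    moreover have "wait_from ?a ?t (\<lambda>x. Suc (T x)) (Suc x) = Suc (T x)" using step by (auto simp: wait_from_def)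
    ultimately show ?case using l loc_ge[OF l] step by auto
  qed
  show "loc \<sigma> A i (wait_from ?a ?t (\<lambda>x. Suc (T x)) ?b) = Some ?b"
    using arr assms(1) by simp
qed

section \<open>Greedy packing of a row\<close>

definition best :: "(nat \<Rightarrow> nat) \<Rightarrow> nat set \<Rightarrow> nat option" where
  "best b S = (if S = {} then None else Some (arg_min_on b S))"

text \<open>Ties are broken by Hilbert choice, so a prefix and the full input get the same winner
  only because the predicates handed to the choice operator coincide.\<close>

lemma best_cong:
  assumes "S = S'" "\<And>i. i \<in> S \<Longrightarrow> b i = b' i"
  shows "best b S = best b' S'"
proof -
  have "is_arg_min b (\<lambda>i. i \<in> S) = is_arg_min b' (\<lambda>i. i \<in> S)"
    using assms(2) by (auto simp: is_arg_min_def fun_eq_iff)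
  then show ?thesis using assms(1) by (simp add: best_def arg_min_on_def arg_min_def)
qed

lemma best_SomeD:
  assumes "best b S = Some i" "finite S"
  shows "i \<in> S" "j \<in> S \<Longrightarrow> b i \<le> b j"
  using assms arg_min_if_finite(1)[of S b] arg_min_least[of S _ b]
  by (auto simp: best_def split: if_splits)

lemma best_exists: "S \<noteq> {} \<Longrightarrow> \<exists>i. best b S = Some i"
  by (simp add: best_def)

text \<open>Greedy interval packing on one row: of the packets present at a node, only one with the
  nearest destination survives.  \<open>C x\<close> holds the packets entering the row at \<open>x\<close>.\<close>

primrec win :: "(nat \<Rightarrow> nat) \<Rightarrow> (nat \<Rightarrow> nat set) \<Rightarrow> nat \<Rightarrow> nat option" where
  "win b C 0 = best b (C 0)"
| "win b C (Suc x) = best b (C (Suc x) \<union> {i. win b C x = Some i \<and> Suc x < b i})"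

text \<open>Needed for the routing to be online: nodes after \<open>x\<close> have no influence on
  the winner at \<open>x\<close>. The winner's destination is carried through the induction because
  the survival test reads it.\<close>

lemma win_cong:
  assumes "\<And>z. z \<le> x \<Longrightarrow> C z = C' z" "\<And>z i. z \<le> x \<Longrightarrow> i \<in> C z \<Longrightarrow> b i = b' i"
    "\<And>z. finite (C z)"
  shows "win b C x = win b' C' x \<and> (\<forall>i. win b C x = Some i \<longrightarrow> b i = b' i)"
  using assms(1,2)
proof (induction x)
  case 0
  have "best b (C 0) = best b' (C' 0)" using 0 by (intro best_cong) auto
  moreover have "\<forall>i. best b (C 0) = Some i \<longrightarrow> b i = b' i"
    using best_SomeD(1)[of b "C 0"] assms(3) 0 by blast
  ultimately show ?case by simp
next
  case (Suc x)
  let ?S = "C (Suc x) \<union> {i. win b C x = Some i \<and> Suc x < b i}"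
  let ?S' = "C' (Suc x) \<union> {i. win b' C' x = Some i \<and> Suc x < b' i}"
  have IH: "win b C x = win b' C' x \<and> (\<forall>i. win b C x = Some i \<longrightarrow> b i = b' i)"
    using Suc by (metis le_SucI)
  have S: "?S = ?S'" using IH Suc.prems(1)[of "Suc x"] by auto
  have b: "b i = b' i" if "i \<in> ?S" for i using that IH Suc.prems(2)[of "Suc x" i] by auto
  have "finite {i. win b C x = Some i \<and> Suc x < b i}"
    by (rule finite_subset[of _ "set_option (win b C x)"]) auto
  then have fin: "finite ?S" using assms(3) by simp
  have "best b ?S = best b' ?S'" by (rule best_cong[OF S b])
  moreover have "\<forall>i. best b ?S = Some i \<longrightarrow> b i = b' i" using best_SomeD(1)[OF _ fin] b by blast
  ultimately show ?case by simp
qed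

locale row_packing =
  fixes a b :: "nat \<Rightarrow> nat" and C :: "nat \<Rightarrow> nat set"
  assumes finite_C: "finite (C x)"
    and C_D: "i \<in> C x \<Longrightarrow> a i = x \<and> x < b i"
begin

lemma win_SomeD:
  assumes "win b C x = Some i"
  shows "i \<in> C (a i)" "a i \<le> x" "x < b i" "\<And>z. a i \<le> z \<Longrightarrow> z \<le> x \<Longrightarrow> win b C z = Some i"
proof -
  have "i \<in> C (a i) \<and> a i \<le> x \<and> x < b i \<and> (\<forall>z. a i \<le> z \<and> z \<le> x \<longrightarrow> win b C z = Some i)"
    using assms
  proof (induction x)
    case 0
    then have "i \<in> C 0" using best_SomeD(1)[OF _ finite_C] by simp
    then show ?case using C_D[of i 0] 0 by auto
  next
    case (Suc x)
    let ?W = "{i. win b C x = Some i \<and> Suc x < b i}"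
    have "finite ?W" by (rule finite_subset[of _ "set_option (win b C x)"]) auto
    then have "i \<in> C (Suc x) \<union> ?W"
      using Suc.prems finite_C by (intro best_SomeD(1)[of b]) auto
    then show ?case
    proof
      assume "i \<in> C (Suc x)"
      moreover have "a i = Suc x" "Suc x < b i" using C_D[OF calculation] by auto
      moreover have "win b C z = Some i" if "a i \<le> z" "z \<le> Suc x" for z
        using that \<open>a i = Suc x\<close> Suc.prems by (metis le_antisym)
      ultimately show ?thesis using \<open>i \<in> C (Suc x)\<close> by (metis le_refl)
    next
      assume "i \<in> ?W"
      then show ?thesis using Suc by (auto simp: le_Suc_eq)
    qed
  qed
  then show "i \<in> C (a i)" "a i \<le> x" "x < b i" "\<And>z. a i \<le> z \<Longrightarrow> z \<le> x \<Longrightarrow> win b C z = Some i"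
    by auto
qed

text \<open>Whoever displaces the current winner has a destination at most as far, so following the
  displacements ends at a packet that is never displaced.\<close>

lemma win_delivers:
  assumes "win b C x = Some i"
  shows "\<exists>d. d \<in> C (a d) \<and> (\<forall>z. a d \<le> z \<and> z < b d \<longrightarrow> win b C z = Some d) \<and> x < b d \<and> b d \<le> b i"
  using assms
proof (induction "b i - x" arbitrary: i x rule: less_induct)
  case less
  note W = win_SomeD[OF less.prems]
  show ?case
  proof (cases "b i = Suc x")
    case True
    then show ?thesis using W by (intro exI[of _ i]) auto
  next
    case False
    let ?W = "{i. win b C x = Some i \<and> Suc x < b i}"
    have i: "i \<in> ?W" using less.prems W(3) False by auto
    then obtain j where j: "win b C (Suc x) = Some j" using best_exists[of "C (Suc x) \<union> ?W" b] by auto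
    have "finite ?W" by (rule finite_subset[of _ "set_option (win b C x)"]) auto
    then have "b j \<le> b i" using j finite_C i by (intro best_SomeD(2)[of b "C (Suc x) \<union> ?W"]) auto
    moreover have "b j - Suc x < b i - x" using \<open>b j \<le> b i\<close> W(3) win_SomeD(3)[OF j] by linarith
    ultimately show ?thesis using less.hyps[OF _ j] by (meson Suc_lessD order_trans)
  qed
qed

text \<open>The charging argument: \<open>i\<close> is charged to a packet \<open>d\<close> that
  completes its trip, and the edge leaving \<open>b d - 1\<close> lies on the way of
  \<open>i\<close>. Bounding the packets of one row over that edge bounds the charge.\<close>

lemma packed_within:
  assumes "i \<in> C (a i)"
  shows "\<exists>d. d \<in> C (a d) \<and> (\<forall>z. a d \<le> z \<and> z < b d \<longrightarrow> win b C z = Some d) \<and> a i < b d \<and> b d \<le> b i"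
proof -
  obtain j where "win b C (a i) = Some j" "b j \<le> b i"
  proof (cases "a i")
    case 0
    then obtain j where "win b C (a i) = Some j" using best_exists[of "C 0" b] assms by auto
    then show ?thesis using that best_SomeD(2)[of b "C 0" j i] finite_C 0 assms by auto
  next
    case (Suc x)
    let ?S = "C (Suc x) \<union> {i. win b C x = Some i \<and> Suc x < b i}"
    obtain j where j: "best b ?S = Some j" using best_exists[of ?S b] assms Suc by auto
    have "finite {i. win b C x = Some i \<and> Suc x < b i}"
      by (rule finite_subset[of _ "set_option (win b C x)"]) auto
    then show ?thesis using that[of j] best_SomeD(2)[OF j, of i] j finite_C Suc assms by auto
  qed
  then show ?thesis using win_delivers by (meson order_trans)
qed

end

section \<open>Load of the sketches of a feasible routing\<close>

lemma card_ex_block_le: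
  fixes u k m :: nat
  assumes "\<And>x. card {i\<in>I. P i x} \<le> m"
  shows "card {i\<in>I. \<exists>x. u \<le> x \<and> x < u + k \<and> P i x} \<le> k * m"
proof -
  have "{i\<in>I. \<exists>x. u \<le> x \<and> x < u + k \<and> P i x} = (\<Union>x\<in>{u..<u+k}. {i\<in>I. P i x})" by auto
  also have "card \<dots> \<le> (\<Sum>x\<in>{u..<u+k}. card {i\<in>I. P i x})" by (rule card_UN_le) simp
  also have "\<dots> \<le> (\<Sum>x\<in>{u..<u+k}. m)" by (intro sum_mono assms)
  finally show ?thesis by simp
qed

locale trajectories =
  fixes c B :: nat and I :: "nat set" and a b y :: "nat \<Rightarrow> nat" and Y :: "nat \<Rightarrow> nat \<Rightarrow> nat"
  assumes ps: "path_system c B I a b y Y"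
begin

lemma finite_I: "finite I" using ps by (simp add: path_system_def)

lemma wait_le: "i \<in> I \<Longrightarrow> a i \<le> x \<Longrightarrow> x < b i \<Longrightarrow> wait_from (a i) (y i) (Y i) x \<le> Y i x"
  using ps by (simp add: path_system_def)

lemma forward_le: "card {i\<in>I. a i \<le> x \<and> x < b i \<and> Y i x = h} \<le> c"
  using ps by (simp add: path_system_def)

lemma keep_le: "card {i\<in>I. a i \<le> x \<and> x < b i \<and> wait_from (a i) (y i) (Y i) x \<le> h \<and> h < Y i x} \<le> B"
  using ps by (simp add: path_system_def)

lemma Y_mono: "i \<in> I \<Longrightarrow> a i \<le> x \<Longrightarrow> x \<le> x' \<Longrightarrow> x' < b i \<Longrightarrow> Y i x \<le> Y i x'"
proof -
  assume i: "i \<in> I" "a i \<le> x" and "x \<le> x'"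
  show "x' < b i \<Longrightarrow> Y i x \<le> Y i x'"
    using \<open>x \<le> x'\<close>
  proof (induction rule: dec_induct)
    case (step z)
    have "Y i z \<le> Y i (Suc z)" using wait_le[OF i(1), of "Suc z"] i step by (auto simp: wait_from_def)
    then show ?case using step by simp
  qed simp
qed

lemma y_le: "i \<in> I \<Longrightarrow> a i \<le> x \<Longrightarrow> x < b i \<Longrightarrow> y i \<le> Y i x"
  using wait_le[of i "a i"] Y_mono[of i "a i" x] by (auto simp: wait_from_def)

text \<open>A discrete intermediate value theorem: a trajectory that is not above \<open>h\<close>
  when it starts at or after \<open>z\<close>, or when it enters \<open>z\<close>, and is above
  \<open>h\<close> when leaving \<open>x'\<close>, uses a vertical edge at height \<open>h\<close>
  in between.\<close>

lemma cross_level: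
  assumes "i \<in> I" "a i \<le> x'" "x' < b i" "h < Y i x'" "z \<le> x'"
    and z: "z \<le> a i \<and> y i \<le> h \<or> a i < z \<and> Y i (z - 1) \<le> h"
  shows "\<exists>x. z \<le> x \<and> x \<le> x' \<and> a i \<le> x \<and> x < b i \<and> wait_from (a i) (y i) (Y i) x \<le> h \<and> h < Y i x"
  using assms(2-5)
proof (induction x')
  case 0
  then show ?case using z by (auto simp: wait_from_def)
next
  case (Suc x')
  show ?case
  proof (cases "a i \<le> x' \<and> z \<le> x' \<and> h < Y i x'")
    case True
    then obtain x where "z \<le> x" "x \<le> x'" "a i \<le> x" "x < b i" "wait_from (a i) (y i) (Y i) x \<le> h" "h < Y i x"
      using Suc.IH Suc.prems(2) by auto
    then show ?thesis by (meson le_SucI)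
  next
    case False
    then consider "\<not> a i \<le> x'" | "a i \<le> x'" "\<not> z \<le> x'" | "a i \<le> x'" "Y i x' \<le> h" by linarith
    then have "wait_from (a i) (y i) (Y i) (Suc x') \<le> h"
    proof cases
      case 1
      then have "a i = Suc x'" using Suc.prems by simp
      then show ?thesis using z Suc.prems by (simp add: wait_from_def)
    next
      case 2
      then have "z = Suc x'" using Suc.prems by simp
      then show ?thesis using z 2 by (simp add: wait_from_def)
    next
      case 3
      then show ?thesis by (simp add: wait_from_def)
    qed
    then show ?thesis using Suc.prems by blast
  qed
qed

lemma forward_block_le: "card {i\<in>I. a i \<le> x \<and> x < b i \<and> u \<le> Y i x \<and> Y i x < u + k} \<le> k * c"
proof -
  have "card {i\<in>I. \<exists>h. u \<le> h \<and> h < u + k \<and> a i \<le> x \<and> x < b i \<and> Y i x = h} \<le> k * c"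
    using forward_le by (rule card_ex_block_le)
  moreover have "{i\<in>I. \<exists>h. u \<le> h \<and> h < u + k \<and> a i \<le> x \<and> x < b i \<and> Y i x = h} =
     {i\<in>I. a i \<le> x \<and> x < b i \<and> u \<le> Y i x \<and> Y i x < u + k}" by blast
  ultimately show ?thesis by simp
qed

lemma keep_block_le:
  "card {i\<in>I. \<exists>x. u \<le> x \<and> x < u + k \<and> a i \<le> x \<and> x < b i \<and> wait_from (a i) (y i) (Y i) x \<le> h \<and> h < Y i x} \<le> k * B"
  using keep_le by (rule card_ex_block_le)

text \<open>A packet leaves its starting grid point over the horizontal or the vertical edge
  there.\<close>

lemma start_le: "card {i\<in>I. a i = x \<and> y i = h \<and> a i < b i} \<le> c + B"
proof -
  let ?F = "{i\<in>I. a i \<le> x \<and> x < b i \<and> Y i x = h}"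
  let ?K = "{i\<in>I. a i \<le> x \<and> x < b i \<and> wait_from (a i) (y i) (Y i) x \<le> h \<and> h < Y i x}"
  have "{i\<in>I. a i = x \<and> y i = h \<and> a i < b i} \<subseteq> ?F \<union> ?K"
  proof
    fix i assume "i \<in> {i\<in>I. a i = x \<and> y i = h \<and> a i < b i}"
    then have i: "i \<in> I" "a i = x" "y i = h" "x < b i" by auto
    then have "h \<le> Y i x" using y_le[of i x] by simp
    then show "i \<in> ?F \<union> ?K" using i by (auto simp: wait_from_def)
  qed
  then have "card {i\<in>I. a i = x \<and> y i = h \<and> a i < b i} \<le> card (?F \<union> ?K)"
    using finite_I by (intro card_mono) auto
  also have "\<dots> \<le> card ?F + card ?K" by (rule card_Un_le)
  also have "\<dots> \<le> c + B" using forward_le keep_le by (intro add_mono)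
  finally show ?thesis .
qed

text \<open>A packet of length at most \<open>D\<close> that crosses the edge at \<open>e\<close>
  starts at one of the \<open>D\<close> nodes ending with \<open>e\<close>.\<close>

lemma short_le: "card {i\<in>I. y i = h \<and> a i \<le> e \<and> e < b i \<and> b i \<le> a i + D} \<le> D * (c + B)"
proof -
  have "{i\<in>I. y i = h \<and> a i \<le> e \<and> e < b i \<and> b i \<le> a i + D} \<subseteq>
      (\<Union>x\<in>{Suc e - D..<Suc e}. {i\<in>I. a i = x \<and> y i = h \<and> a i < b i})"
    by auto
  then have "card {i\<in>I. y i = h \<and> a i \<le> e \<and> e < b i \<and> b i \<le> a i + D} \<le>
      card (\<Union>x\<in>{Suc e - D..<Suc e}. {i\<in>I. a i = x \<and> y i = h \<and> a i < b i})"
    using finite_I by (intro card_mono) auto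
  also have "\<dots> \<le> (\<Sum>x\<in>{Suc e - D..<Suc e}. card {i\<in>I. a i = x \<and> y i = h \<and> a i < b i})"
    by (rule card_UN_le) simp
  also have "\<dots> \<le> (\<Sum>x\<in>{Suc e - D..<Suc e}. c + B)" by (intro sum_mono start_le)
  also have "\<dots> \<le> D * (c + B)" by simp (intro conjI impI; linarith)
  finally show ?thesis .
qed

end

section \<open>Tiles and clamped sketches\<close>

lemma tile_bounds:
  fixes x K :: nat
  assumes "0 < K"
  shows "x div K * K \<le> x" "x < x div K * K + K"
  using assms div_mult_mod_eq[of x K] mod_less_divisor[of K x] by linarith+

lemma div_eq_iff_tile: "0 < K \<Longrightarrow> x div K = X \<longleftrightarrow> X * K \<le> x \<and> x < X * K + K" for x K :: nat
  by (metis add.commute div_nat_eqI mult.commute mult_Suc_right tile_bounds)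

text \<open>Tiles are \<open>K\<close> by \<open>K\<close> squares.  A trajectory induces the sketch \<open>\<rho>\<close>, the tile row in which it
  leaves each tile column; \<open>\<rho>'\<close> is the sketch after three clampings whose extra load is bounded:
  the sketch starts one tile row above the source and ends in a tile row lying entirely before the
  deadline, and a packet reaching a tile row divisible by \<open>n\<close> within tile column \<open>X\<close>
  climbs at most \<open>X\<close> further tile rows, so that the packets stopped there spread over \<open>n\<close> tile rows.\<close>

locale tiled_trajectories = trajectories +
  fixes n K :: nat and U :: "nat \<Rightarrow> nat"
  assumes K_pos: "0 < K"
    and b_less: "i \<in> I \<Longrightarrow> b i < n"
    and far: "i \<in> I \<Longrightarrow> a i div K + 2 \<le> b i div K"
begin

definition \<rho> where "\<rho> i X = Y i (X * K + K - 1) div K"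
abbreviation Xa where "Xa i \<equiv> a i div K"
abbreviation Xb where "Xb i \<equiv> b i div K"
abbreviation Ra where "Ra i \<equiv> y i div K"
text \<open>The first multiple of \<open>n\<close> above the tile row in which the sketch
  starts.\<close>

definition base where "base i = n * (Suc (Ra i) div n + 1)"
text \<open>The column in which the climb reaches \<open>base i\<close>. Before
  \<open>\<rho>\<close> reaches \<open>base i\<close> the cap \<open>base i + turn i\<close> has no
  effect, whatever value \<open>LEAST\<close> takes.\<close>

definition turn where "turn i = (LEAST X. Xa i \<le> X \<and> base i \<le> \<rho> i X)"
definition \<rho>' where "\<rho>' i X = (if X = Xa i then Suc (Ra i)
   else max (Suc (Ra i)) (min (\<rho> i X) (min (U i) (base i + turn i))))"

lemma edge_in:
  assumes "i \<in> I" "Xa i \<le> X" "X < Xb i"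
  shows "a i \<le> X * K + K - 1" "X * K + K - 1 < b i"
proof -
  have "a i < Xa i * K + K" using K_pos tile_bounds by blast
  also have "\<dots> \<le> X * K + K" using assms(2) by simp
  finally show "a i \<le> X * K + K - 1" by simp
  have "X * K + K \<le> Xb i * K" using assms(3) by (metis Suc_leI add.commute mult_Suc mult_le_mono1)
  also have "\<dots> \<le> b i" using K_pos tile_bounds by blast
  finally show "X * K + K - 1 < b i" using K_pos by simp
qed

lemma \<rho>_mono: "i \<in> I \<Longrightarrow> Xa i \<le> X \<Longrightarrow> X \<le> X' \<Longrightarrow> X' < Xb i \<Longrightarrow> \<rho> i X \<le> \<rho> i X'"
  unfolding \<rho>_def using edge_in[of i X] edge_in[of i X']
  by (intro div_le_mono Y_mono) (auto intro!: diff_le_mono)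

lemma \<rho>_ge: "i \<in> I \<Longrightarrow> Xa i \<le> X \<Longrightarrow> X < Xb i \<Longrightarrow> Ra i \<le> \<rho> i X"
  unfolding \<rho>_def using edge_in[of i X] by (intro div_le_mono y_le) auto

lemma \<rho>'_mono:
  assumes "i \<in> I" "Xa i \<le> X" "X \<le> X'" "X' < Xb i"
  shows "\<rho>' i X \<le> \<rho>' i X'"
  using assms \<rho>_mono[OF assms] unfolding \<rho>'_def by auto

lemma base_gr: "0 < n \<Longrightarrow> Suc (Ra i) < base i"
  using tile_bounds(2)[of n "Suc (Ra i)"] by (simp add: base_def mult.commute)

lemma base_le: "base i \<le> Suc (Ra i) + n"
  using div_times_less_eq_dividend[of "Suc (Ra i)" n] by (simp add: base_def mult.commute)

lemma n_pos: "i \<in> I \<Longrightarrow> 0 < n" using b_less by fastforce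

lemma turnD:
  assumes "i \<in> I" "Xa i \<le> X" "X < Xb i" "base i \<le> \<rho> i X"
  shows "Xa i \<le> turn i" "base i \<le> \<rho> i (turn i)" "turn i \<le> X" "turn i < n"
    "Xa i < turn i \<Longrightarrow> \<rho> i (turn i - 1) < base i"
proof -
  have *: "Xa i \<le> X \<and> base i \<le> \<rho> i X" using assms by simp
  show "Xa i \<le> turn i" "base i \<le> \<rho> i (turn i)" using LeastI[of "\<lambda>X. Xa i \<le> X \<and> base i \<le> \<rho> i X", OF *]
    by (auto simp: turn_def)
  show t: "turn i \<le> X" unfolding turn_def by (rule Least_le) (rule *)
  have "b i div K \<le> b i" by (rule div_le_dividend)
  then show "turn i < n" using t assms(3) b_less[OF assms(1)] by linarith
  show "\<rho> i (turn i - 1) < base i" if "Xa i < turn i"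
  proof -
    have "\<not> (Xa i \<le> turn i - 1 \<and> base i \<le> \<rho> i (turn i - 1))"
      using that not_less_Least[of "turn i - 1" "\<lambda>X. Xa i \<le> X \<and> base i \<le> \<rho> i X"]
      by (simp add: turn_def)
    then show ?thesis using that by linarith
  qed
qed

lemma \<rho>'_top:
  assumes "i \<in> I" "Xa i \<le> X" "X < Xb i"
  shows "\<rho>' i X \<le> Suc (Ra i) + 2 * n"
proof (cases "base i \<le> \<rho> i X")
  case True
  then show ?thesis using turnD(4)[OF assms True] base_le[of i] by (auto simp: \<rho>'_def)
next
  case False
  then show ?thesis using base_le[of i] by (auto simp: \<rho>'_def)
qed

lemma \<rho>_less_imp: "\<rho> i X \<le> R \<Longrightarrow> Y i (X * K + K - 1) \<le> R * K + K - 1"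
  using tile_bounds(2)[OF K_pos, of "Y i (X * K + K - 1)"] mult_le_mono1[of "\<rho> i X" R K]
  unfolding \<rho>_def by linarith

lemma \<rho>_greater_imp:
  assumes "R < \<rho> i X"
  shows "R * K + K - 1 < Y i (X * K + K - 1)"
proof -
  have "Suc R * K \<le> \<rho> i X * K" using assms by (intro mult_le_mono1) simp
  also have "\<dots> \<le> Y i (X * K + K - 1)" unfolding \<rho>_def by (rule tile_bounds(1)[OF K_pos])
  finally show ?thesis using K_pos by (simp add: add.commute)
qed

lemma source_row_imp: "Ra i \<le> R \<Longrightarrow> y i \<le> R * K + K - 1"
  using tile_bounds(2)[OF K_pos, of "y i"] mult_le_mono1[of "Ra i" R K] by linarith

text \<open>A far packet leaves its source tile through the right side, \<open>K\<close> rows with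
  \<open>c\<close> packets each, or through the top, \<open>K\<close> nodes with \<open>B\<close>
  packets each.\<close>

lemma source_tile_le: "card {i\<in>I. Xa i = X \<and> Ra i = R} \<le> K * (c + B)"
proof -
  let ?F = "{i\<in>I. a i \<le> X * K + K - 1 \<and> X * K + K - 1 < b i \<and> R * K \<le> Y i (X * K + K - 1) \<and> Y i (X * K + K - 1) < R * K + K}"
  let ?G = "{i\<in>I. \<exists>x. X * K \<le> x \<and> x < X * K + K \<and> a i \<le> x \<and> x < b i \<and>
     wait_from (a i) (y i) (Y i) x \<le> R * K + K - 1 \<and> R * K + K - 1 < Y i x}"
  have "{i\<in>I. Xa i = X \<and> Ra i = R} \<subseteq> ?F \<union> ?G"
  proof
    fix i assume "i \<in> {i\<in>I. Xa i = X \<and> Ra i = R}"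
    then have i: "i \<in> I" "Xa i = X" "Ra i = R" by auto
    have X: "Xa i \<le> X" "X < Xb i" using i far[of i] by auto
    note e = edge_in[OF i(1) X]
    show "i \<in> ?F \<union> ?G"
    proof (cases "\<rho> i X = R")
      case True
      then show ?thesis using e i div_eq_iff_tile[OF K_pos] unfolding \<rho>_def by auto
    next
      case False
      then have "R < \<rho> i X" using \<rho>_ge[OF i(1) X] i by simp
      moreover have "y i \<le> R * K + K - 1" "X * K \<le> a i" 
        using source_row_imp[of i R] i tile_bounds[OF K_pos, of "a i"] by auto
      moreover have "X * K \<le> X * K + K - 1" using K_pos by simp
      ultimately have "\<exists>x. X * K \<le> x \<and> x \<le> X * K + K - 1 \<and> a i \<le> x \<and> x < b i \<and>
         wait_from (a i) (y i) (Y i) x \<le> R * K + K - 1 \<and> R * K + K - 1 < Y i x"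
        using i e by (intro cross_level \<rho>_greater_imp) auto
      then obtain x where "X * K \<le> x \<and> x \<le> X * K + K - 1 \<and> a i \<le> x \<and> x < b i \<and>
         wait_from (a i) (y i) (Y i) x \<le> R * K + K - 1 \<and> R * K + K - 1 < Y i x" ..
      moreover then have "x < X * K + K" using K_pos by linarith
      ultimately have "i \<in> ?G" using i(1) by blast
      then show ?thesis ..
    qed
  qed
  then have "card {i\<in>I. Xa i = X \<and> Ra i = R} \<le> card (?F \<union> ?G)"
    using finite_I by (intro card_mono) auto
  also have "\<dots> \<le> card ?F + card ?G" by (rule card_Un_le)
  also have "\<dots> \<le> K * c + K * B" by (intro add_mono forward_block_le keep_block_le)
  finally show ?thesis by (simp add: algebra_simps)
qed

lemma sketch_row_le: "card {i\<in>I. Xa i \<le> X \<and> X < Xb i \<and> \<rho> i X = R} \<le> K * c"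
proof -
  have "card {i\<in>I. Xa i \<le> X \<and> X < Xb i \<and> \<rho> i X = R} \<le>
    card {i\<in>I. a i \<le> X * K + K - 1 \<and> X * K + K - 1 < b i \<and> R * K \<le> Y i (X * K + K - 1) \<and> Y i (X * K + K - 1) < R * K + K}"
    using finite_I edge_in div_eq_iff_tile[OF K_pos] unfolding \<rho>_def by (intro card_mono) auto
  also have "\<dots> \<le> K * c" by (rule forward_block_le)
  finally show ?thesis .
qed

text \<open>These packets rise from tile row \<open>R\<close> into \<open>base i\<close> inside one
  tile column, hence through the top side of a single tile.\<close>

lemma sketch_turn_le:
  "card {i\<in>I. \<exists>X. Xa i \<le> X \<and> X < Xb i \<and> base i \<le> \<rho> i X \<and> turn i = X' \<and> base i = Suc R} \<le> K * B" (is "card ?S \<le> _")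
proof -
  let ?G = "{i\<in>I. \<exists>x. X' * K \<le> x \<and> x < X' * K + K \<and> a i \<le> x \<and> x < b i \<and>
     wait_from (a i) (y i) (Y i) x \<le> R * K + K - 1 \<and> R * K + K - 1 < Y i x}"
  have "?S \<subseteq> ?G"
  proof
    fix i assume "i \<in> ?S"
    then obtain X where i: "i \<in> I" "Xa i \<le> X" "X < Xb i" "base i \<le> \<rho> i X" "turn i = X'" "base i = Suc R" by auto
    note t = turnD[OF i(1-4), unfolded i(5,6)]
    note e = edge_in[OF i(1) t(1) le_less_trans[OF t(3) i(3)]]
    have Ra: "Ra i \<le> R" using base_gr[OF n_pos[OF i(1)], of i] i by simp
    have z: "X' * K \<le> a i \<and> y i \<le> R * K + K - 1 \<or> a i < X' * K \<and> Y i (X' * K - 1) \<le> R * K + K - 1"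
    proof (cases "Xa i < X'")
      case True
      then have "\<rho> i (X' - 1) \<le> R" using t by simp
      from \<rho>_less_imp[OF this] have "Y i ((X' - 1) * K + K - 1) \<le> R * K + K - 1" .
      moreover have "(X' - 1) * K + K = X' * K" using True by (cases X') auto
      moreover have "a i < X' * K" using True K_pos by (simp add: div_less_iff_less_mult)
      ultimately show ?thesis by simp
    next
      case False
      then have "Xa i = X'" using t by simp
      then show ?thesis using tile_bounds(1)[OF K_pos, of "a i"] source_row_imp[OF Ra] by auto
    qed
    have "\<exists>x. X' * K \<le> x \<and> x \<le> X' * K + K - 1 \<and> a i \<le> x \<and> x < b i \<and>
         wait_from (a i) (y i) (Y i) x \<le> R * K + K - 1 \<and> R * K + K - 1 < Y i x"
      using i e z t K_pos by (intro cross_level \<rho>_greater_imp) auto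
    then obtain x where "X' * K \<le> x \<and> x \<le> X' * K + K - 1 \<and> a i \<le> x \<and> x < b i \<and>
       wait_from (a i) (y i) (Y i) x \<le> R * K + K - 1 \<and> R * K + K - 1 < Y i x" ..
    moreover then have "x < X' * K + K" using K_pos by linarith
    ultimately show "i \<in> ?G" using i(1) by blast
  qed
  then have "card ?S \<le> card ?G" using finite_I by (intro card_mono) auto
  also have "\<dots> \<le> K * B" by (rule keep_block_le)
  finally show ?thesis .
qed

text \<open>A packet shows up in tile row \<open>R\<close> because it starts there, because its true
  sketch is there, because it was lifted by one row to the start row, lowered by one row for its
  deadline, or stopped at \<open>base i + turn i\<close>. Each cause is bounded by the traffic
  through sides of one tile.\<close>

lemma row_load_le:
  assumes U: "\<And>i. i \<in> I \<Longrightarrow> U i = \<rho> i (Xb i - 1) \<or> Suc (U i) = \<rho> i (Xb i - 1) \<and> Suc (Ra i) \<le> U i"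
  shows "card {i\<in>I. Xa i \<le> X \<and> X < Xb i \<and> \<rho>' i X = R} \<le> 4 * (K * (c + B))"
proof -
  let ?S1 = "{i\<in>I. Xa i = X \<and> Ra i = R - 1}"
  let ?S = "\<lambda>R. {i\<in>I. Xa i \<le> X \<and> X < Xb i \<and> \<rho> i X = R}"
  \<comment> \<open>As \<open>base i\<close> is a multiple of \<open>n\<close> and
    \<open>turn i < n\<close>, the sum \<open>base i + turn i = R\<close> determines both
    terms.\<close>
  let ?m = "R - R mod n"
  let ?T = "{i\<in>I. \<exists>X. Xa i \<le> X \<and> X < Xb i \<and> base i \<le> \<rho> i X \<and> turn i = R mod n \<and> base i = Suc (?m - 1)}"
  have "{i\<in>I. Xa i \<le> X \<and> X < Xb i \<and> \<rho>' i X = R} \<subseteq> ?S1 \<union> (?S R \<union> ?S (R - 1) \<union> ?S (Suc R) \<union> ?T)"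
  proof
    fix i assume "i \<in> {i\<in>I. Xa i \<le> X \<and> X < Xb i \<and> \<rho>' i X = R}"
    then have i: "i \<in> I" "Xa i \<le> X" "X < Xb i" "\<rho>' i X = R" by auto
    have up: "\<rho> i X \<le> \<rho> i (Xb i - 1)" using i by (intro \<rho>_mono) auto
    have ge: "Ra i \<le> \<rho> i X" using \<rho>_ge i by simp
    have bg: "Suc (Ra i) < base i" using base_gr n_pos i by simp
    show "i \<in> ?S1 \<union> (?S R \<union> ?S (R - 1) \<union> ?S (Suc R) \<union> ?T)"
    proof (cases "X = Xa i")
      case True
      then have "R = Suc (Ra i)" using i(4) by (simp add: \<rho>'_def)
      then have "i \<in> ?S1" using True i(1) by simp
      then show ?thesis by (rule UnI1)
    next
      case False
      then have R: "R = max (Suc (Ra i)) (min (\<rho> i X) (min (U i) (base i + turn i)))"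
        using i(4) by (simp add: \<rho>'_def)
      consider "\<rho> i X = R" | "\<rho> i X = R - 1" | "\<rho> i X = Suc R" | "R = base i + turn i" "base i \<le> \<rho> i X"
      proof -
        consider "\<rho> i X \<le> U i" "\<rho> i X \<le> base i + turn i" | "U i < \<rho> i X" "U i \<le> base i + turn i"
          | "base i + turn i < \<rho> i X" "base i + turn i < U i" by linarith
        then show thesis
        proof cases
          case 1
          then have "R = max (Suc (Ra i)) (\<rho> i X)" using R by simp
          then show thesis using ge that(1,2) by (cases "\<rho> i X = Ra i") auto
        next
          case 2
          then have "Suc (U i) = \<rho> i (Xb i - 1)" "Suc (Ra i) \<le> U i" using U[OF i(1)] up by auto
          then have "R = U i" "\<rho> i X = Suc (U i)" using R 2 up by simp_all
          then show thesis using that(3) by simp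
        next
          case 3
          then have "R = base i + turn i" using R bg by simp
          then show thesis using that(4) 3 by simp
        qed
      qed
      then show ?thesis
      proof cases
        case 4
        have t: "turn i < n" using turnD[OF i(1-3) 4(2)] by simp
        obtain q where "base i = n * q" using base_def by blast
        then have m: "turn i = R mod n" using 4(1) t by simp
        then have "base i = ?m" using 4(1) by linarith
        then have "base i = Suc (?m - 1)" using bg by linarith
        then have "i \<in> ?T" using i(1-3) 4(2) m by blast
        then show ?thesis by (rule UnI2[OF UnI2])
      qed (use i(1-3) in simp_all)
    qed
  qed
  then have "card {i\<in>I. Xa i \<le> X \<and> X < Xb i \<and> \<rho>' i X = R} \<le>
      card (?S1 \<union> (?S R \<union> ?S (R - 1) \<union> ?S (Suc R) \<union> ?T))"
    using finite_I by (intro card_mono) auto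
  also have "\<dots> \<le> card ?S1 + (card (?S R) + card (?S (R - 1)) + card (?S (Suc R)) + card ?T)"
    by (intro order_trans[OF card_Un_le] add_mono order_refl)
  also have "\<dots> \<le> K * (c + B) + (K * c + K * c + K * c + K * B)"
    by (intro add_mono source_tile_le sketch_row_le sketch_turn_le)
  also have "\<dots> \<le> 4 * (K * (c + B))" by (simp add: algebra_simps)
  finally show ?thesis .
qed

text \<open>A step of the clamped sketch between columns \<open>X - 1\<close> and \<open>X\<close>
  is a true climb within these two columns. The earlier one matters when it is the source column,
  where the clamped value is forced to the start row although the packet may already have
  climbed.\<close>

lemma column_load_le:
  "card {i\<in>I. Xa i < X \<and> X < Xb i \<and> \<rho>' i (X - 1) \<le> R \<and> R < \<rho>' i X} \<le> 4 * (K * (c + B))" (is "card ?S \<le> _")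
proof -
  let ?h = "R * K + K - 1"
  let ?G = "{i\<in>I. \<exists>x. (X - 1) * K \<le> x \<and> x < (X - 1) * K + 2 * K \<and> a i \<le> x \<and> x < b i \<and>
     wait_from (a i) (y i) (Y i) x \<le> ?h \<and> ?h < Y i x}"
  have "?S \<subseteq> ?G"
  proof
    fix i assume "i \<in> ?S"
    then have i: "i \<in> I" "Xa i < X" "X < Xb i" "\<rho>' i (X - 1) \<le> R" "R < \<rho>' i X" by auto
    have X: "(X - 1) * K + K = X * K" using i(2) by (cases X) auto
    have "Suc (Ra i) \<le> \<rho>' i (X - 1)" by (auto simp: \<rho>'_def)
    then have Ra: "Ra i < R" using i(4) by simp
    have gr: "R < \<rho> i X" using i(2,5) Ra by (auto simp: \<rho>'_def)
    note e = edge_in[OF i(1) less_imp_le[OF i(2)] i(3)]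
    have z: "(X - 1) * K \<le> a i \<and> y i \<le> ?h \<or> a i < X * K \<and> Y i (X * K - 1) \<le> ?h"
    proof (cases "Xa i = X - 1")
      case True
      then show ?thesis using tile_bounds(1)[OF K_pos, of "a i"] source_row_imp[of i R] Ra by auto
    next
      case False
      \<comment> \<open>Both columns share the same upper cap, which exceeds \<open>R\<close>
        because \<open>\<rho>' i X\<close> does; so the low value at \<open>X - 1\<close> comes from
        \<open>\<rho>\<close> itself.\<close>
      have "\<rho> i (X - 1) \<le> R"
        using i(2,4,5) False by (auto simp: \<rho>'_def split: if_splits)
      from \<rho>_less_imp[OF this] have "Y i (X * K - 1) \<le> ?h" using X by simp
      moreover have "a i < X * K" using i(2) K_pos by (simp add: div_less_iff_less_mult)
      ultimately show ?thesis by simp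
    qed
    have "\<exists>x. (X - 1) * K \<le> x \<and> x \<le> X * K + K - 1 \<and> a i \<le> x \<and> x < b i \<and>
         wait_from (a i) (y i) (Y i) x \<le> ?h \<and> ?h < Y i x"
      using z
    proof
      assume "(X - 1) * K \<le> a i \<and> y i \<le> ?h"
      then show ?thesis using i e X gr by (intro cross_level \<rho>_greater_imp) auto
    next
      assume *: "a i < X * K \<and> Y i (X * K - 1) \<le> ?h"
      then have "\<exists>x. X * K \<le> x \<and> x \<le> X * K + K - 1 \<and> a i \<le> x \<and> x < b i \<and>
         wait_from (a i) (y i) (Y i) x \<le> ?h \<and> ?h < Y i x"
        using i e gr K_pos by (intro cross_level \<rho>_greater_imp) auto
      then show ?thesis using X by (meson diff_le_self mult_le_mono1 order_trans)
    qed
    then obtain x where x: "(X - 1) * K \<le> x \<and> x \<le> X * K + K - 1 \<and> a i \<le> x \<and> x < b i \<and>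
       wait_from (a i) (y i) (Y i) x \<le> ?h \<and> ?h < Y i x" ..
    then have "x < (X - 1) * K + 2 * K" using K_pos X by linarith
    with x show "i \<in> ?G" using i(1) by blast
  qed
  then have "card ?S \<le> card ?G" using finite_I by (intro card_mono) auto
  also have "\<dots> \<le> 2 * K * B" by (rule keep_block_le)
  also have "\<dots> \<le> 4 * (K * (c + B))" by (simp add: algebra_simps)
  finally show ?thesis .
qed

end

section \<open>Online packing of sketch paths\<close>

definition level :: "nat \<Rightarrow> nat \<Rightarrow> nat" where
  "level u v = floor_log (v - u)"

text \<open>A quotient rounded up: \<open>anchor u v * 2 ^ level u v\<close> is the first multiple
  of that power at or after \<open>u\<close>. It lies before \<open>v\<close> because the power is
  at most \<open>v - u\<close>.\<close>

definition anchor :: "nat \<Rightarrow> nat \<Rightarrow> nat" where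
  "anchor u v = (u + 2 ^ level u v - 1) div 2 ^ level u v"

lemma anchor_bounds:
  assumes "u < v"
  shows "u \<le> anchor u v * 2 ^ level u v" "anchor u v * 2 ^ level u v < v"
proof -
  let ?p = "2 ^ level u v :: nat"
  have p: "?p \<le> v - u" "0 < ?p" using assms floor_log_exp2_le[of "v - u"] by (auto simp: level_def)
  note t = tile_bounds[OF p(2), of "u + ?p - 1"]
  show "u \<le> anchor u v * ?p" using t(2) p(2) unfolding anchor_def by linarith
  show "anchor u v * ?p < v" using t(1) p assms unfolding anchor_def by linarith
qed

lemma less_exp_level: "v < u + 2 * 2 ^ level u v"
  using floor_log_exp2_gt[of "v - u"] by (simp add: level_def)

lemma level_less:
  assumes "u < v" "v - u < 2 ^ L"
  shows "level u v < L"
proof -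
  have "(2::nat) ^ level u v \<le> v - u" using assms(1) floor_log_exp2_le[of "v - u"] by (simp add: level_def)
  then have "(2::nat) ^ level u v < 2 ^ L" using assms(2) by linarith
  then show ?thesis by simp
qed

text \<open>A run of level \<open>l\<close> has length below \<open>2\<^sup>l\<^sup>+\<^sup>1\<close>, so the anchors of touching runs of that level
  differ by less than 4.\<close>

lemma anchor_eq:
  assumes "u < v" "u' < v'" and lev: "level u v = level u' v'"
    and "anchor u v mod 4 = anchor u' v' mod 4"
    and "u \<le> z" "z \<le> v" "u' \<le> z" "z \<le> v'"
  shows "anchor u v = anchor u' v'"
proof -
  let ?p = "2 ^ level u v :: nat" and ?q = "anchor u v" and ?q' = "anchor u' v'"
  have "?q * ?p < ?q' * ?p + 4 * ?p" "?q' * ?p < ?q * ?p + 4 * ?p"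
    using anchor_bounds[OF assms(1)] anchor_bounds[OF assms(2)] less_exp_level[of v u] less_exp_level[of v' u']
      assms(5-8) unfolding lev by linarith+
  then have "?q * ?p < (?q' + 4) * ?p" "?q' * ?p < (?q + 4) * ?p" by (simp_all add: algebra_simps)
  then have "?q < ?q' + 4" "?q' < ?q + 4" 
    using mult_less_cancel2[of ?q ?p "?q' + 4"] mult_less_cancel2[of ?q' ?p "?q + 4"] by blast+
  then have "?q div 4 < Suc (?q' div 4)" "?q' div 4 < Suc (?q div 4)"
    using assms(4) div_mult_mod_eq[of ?q 4] div_mult_mod_eq[of ?q' 4] by linarith+
  then show ?thesis using assms(4) div_mult_mod_eq[of ?q 4] div_mult_mod_eq[of ?q' 4] by linarith
qed

type_synonym key = "bool \<times> nat \<times> nat \<times> nat"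

text \<open>A sketch path is a nondecreasing function \<open>\<rho>\<close> from tile columns to tile rows.  Its maximal
  horizontal and vertical runs are the items packed online; a run is charged to the key consisting
  of its line, its level and its anchor, so that all runs with the same key share an edge.\<close>

locale line_grid =
  fixes n L K :: nat
  assumes n_pos: "0 < n" and L: "2 * n < 2 ^ L" and K_eq: "K = 4 * L * L"
begin

definition sx where "sx r = src r div K"
definition dx where "dx r = dst r div K"
definition sy where "sy r = row0 n r div K"

text \<open>A packet arriving along row \<open>y\<close> reaches \<open>dst r\<close> in step
  \<open>y + dst r - n\<close>. The last row of tile row \<open>R\<close> is tested, so every offset
  inside the tile row is on time.\<close>

definition in_time :: "request \<Rightarrow> nat \<Rightarrow> bool" where
  "in_time r R \<longleftrightarrow> enat (R * K + K - 1 + dst r) \<le> ddl r + enat n"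

definition far :: "request \<Rightarrow> bool" where
  "far r \<longleftrightarrow> sx r + 2 \<le> dx r \<and> dst r < n \<and> in_time r (Suc (sy r))"

text \<open>The final bound keeps every climb below \<open>2 ^ L\<close> and thereby every vertical
  level below \<open>L\<close>.\<close>

definition sketch :: "request \<Rightarrow> (nat \<Rightarrow> nat) \<Rightarrow> bool" where
  "sketch r \<rho> \<longleftrightarrow> (\<forall>X X'. sx r \<le> X \<and> X \<le> X' \<and> X' < dx r \<longrightarrow> \<rho> X \<le> \<rho> X')
     \<and> \<rho> (sx r) = Suc (sy r) \<and> in_time r (\<rho> (dx r - 1)) \<and> \<rho> (dx r - 1) \<le> Suc (sy r) + 2 * n"

definition run :: "request \<Rightarrow> (nat \<Rightarrow> nat) \<Rightarrow> nat \<Rightarrow> nat set" where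
  "run r \<rho> R = {X. sx r \<le> X \<and> X < dx r \<and> \<rho> X = R}"

text \<open>Column \<open>X\<close> stands for the side between tile columns \<open>X\<close> and
  \<open>Suc X\<close>; \<open>Suc (Max ...)\<close> makes the run a half-open interval of such
  sides.\<close>

definition hkey :: "request \<Rightarrow> (nat \<Rightarrow> nat) \<Rightarrow> nat \<Rightarrow> key" where
  "hkey r \<rho> R = (let u = Min (run r \<rho> R); v = Suc (Max (run r \<rho> R)) in (True, R, level u v, anchor u v))"

definition vkey :: "(nat \<Rightarrow> nat) \<Rightarrow> nat \<Rightarrow> key" where
  "vkey \<rho> X = (False, X, level (\<rho> (X - 1)) (\<rho> X), anchor (\<rho> (X - 1)) (\<rho> X))"

definition turns :: "request \<Rightarrow> (nat \<Rightarrow> nat) \<Rightarrow> nat set" where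
  "turns r \<rho> = {X. sx r < X \<and> X < dx r \<and> \<rho> (X - 1) < \<rho> X}"

definition keys :: "request \<Rightarrow> (nat \<Rightarrow> nat) \<Rightarrow> key set" where
  "keys r \<rho> = hkey r \<rho> ` \<rho> ` {sx r..<dx r} \<union> vkey \<rho> ` turns r \<rho>"

text \<open>The solution of \<open>w 0 = 0\<close>,
  \<open>w (Suc m) = 2 * w m + 1 / (2 * n)\<close>. The denominator is the bound on the number of
  keys of a path, so the additive terms of one accepted path sum to at most 1.\<close>

definition weight :: "nat \<Rightarrow> real" where
  "weight m = (2 ^ m - 1) / (2 * n)"

definition admit :: "request \<Rightarrow> bool \<Rightarrow> (key \<Rightarrow> nat) \<Rightarrow> (nat \<Rightarrow> nat) option" where
  "admit r blocked load =
     (if far r \<and> \<not> blocked \<and> (\<exists>\<rho>. sketch r \<rho> \<and> (\<Sum>k\<in>keys r \<rho>. weight (load k)) < 1)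
      then Some (SOME \<rho>. sketch r \<rho> \<and> (\<Sum>k\<in>keys r \<rho>. weight (load k)) < 1) else None)"

text \<open>The recursive calls stand behind \<open>j < i\<close> in a conjunction; the congruence
  rule passes this bound to the termination proof.\<close>

declare conj_cong [fundef_cong]

function path :: "request list \<Rightarrow> nat \<Rightarrow> (nat \<Rightarrow> nat) option" where
  "path \<sigma> i = admit (\<sigma> ! i)
     (\<exists>j<i. path \<sigma> j \<noteq> None \<and> sx (\<sigma> ! j) = sx (\<sigma> ! i) \<and> sy (\<sigma> ! j) = sy (\<sigma> ! i))
     (\<lambda>k. card {j\<in>{..<i}. \<exists>\<rho>. path \<sigma> j = Some \<rho> \<and> k \<in> keys (\<sigma> ! j) \<rho>})"
  by auto
termination by (relation "measure snd") auto

declare path.simps [simp del] and conj_cong [fundef_cong del]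

definition load :: "request list \<Rightarrow> nat \<Rightarrow> key \<Rightarrow> nat" where
  "load \<sigma> i k = card {j\<in>{..<i}. \<exists>\<rho>. path \<sigma> j = Some \<rho> \<and> k \<in> keys (\<sigma> ! j) \<rho>}"

definition blocked :: "request list \<Rightarrow> nat \<Rightarrow> bool" where
  "blocked \<sigma> i \<longleftrightarrow> (\<exists>j<i. path \<sigma> j \<noteq> None \<and> sx (\<sigma> ! j) = sx (\<sigma> ! i) \<and> sy (\<sigma> ! j) = sy (\<sigma> ! i))"

lemma path_eq: "path \<sigma> i = admit (\<sigma> ! i) (blocked \<sigma> i) (load \<sigma> i)"
  unfolding path.simps[of \<sigma> i] load_def blocked_def ..

lemma K_pos: "0 < K" using L K_eq n_pos by (cases L) auto

lemma path_SomeD: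
  assumes "path \<sigma> i = Some \<rho>"
  shows "far (\<sigma> ! i)" "\<not> blocked \<sigma> i" "sketch (\<sigma> ! i) \<rho>" "(\<Sum>k\<in>keys (\<sigma> ! i) \<rho>. weight (load \<sigma> i k)) < 1"
proof -
  let ?P = "\<lambda>\<rho>. sketch (\<sigma> ! i) \<rho> \<and> (\<Sum>k\<in>keys (\<sigma> ! i) \<rho>. weight (load \<sigma> i k)) < 1"
  have *: "far (\<sigma> ! i) \<and> \<not> blocked \<sigma> i \<and> (\<exists>\<rho>. ?P \<rho>) \<and> \<rho> = (SOME \<rho>. ?P \<rho>)"
    using assms by (auto simp: path_eq admit_def split: if_splits)
  then have "?P \<rho>" using someI_ex[of ?P] by simp
  with * show "far (\<sigma> ! i)" "\<not> blocked \<sigma> i" "sketch (\<sigma> ! i) \<rho>" "(\<Sum>k\<in>keys (\<sigma> ! i) \<rho>. weight (load \<sigma> i k)) < 1"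
    by auto
qed

lemma path_NoneD:
  assumes "path \<sigma> i = None" "far (\<sigma> ! i)" "\<not> blocked \<sigma> i" "sketch (\<sigma> ! i) \<rho>"
  shows "1 \<le> (\<Sum>k\<in>keys (\<sigma> ! i) \<rho>. weight (load \<sigma> i k))"
proof (rule ccontr)
  assume "\<not> ?thesis"
  then show False using assms by (auto simp: path_eq admit_def not_le split: if_splits)
qed

text \<open>The choice in \<open>admit\<close> reads only the request itself and the outcomes of
  earlier ones, so decisions on a prefix persist.\<close>

lemma path_take: "m \<le> length \<sigma> \<Longrightarrow> i < m \<Longrightarrow> path (take m \<sigma>) i = path \<sigma> i"
proof (induction i rule: less_induct)
  case (less i)
  have IH: "path (take m \<sigma>) j = path \<sigma> j" if "j < i" for j using that less by auto
  have "blocked (take m \<sigma>) i = blocked \<sigma> i"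
    using IH less.prems unfolding blocked_def by auto
  moreover have "load (take m \<sigma>) i = load \<sigma> i"
    unfolding load_def using IH less.prems by (intro ext arg_cong[of _ _ card]) auto
  ultimately show ?case using less.prems by (simp add: path_eq)
qed

lemma load_take: "m \<le> length \<sigma> \<Longrightarrow> i \<le> m \<Longrightarrow> load (take m \<sigma>) i = load \<sigma> i"
  unfolding load_def using path_take by (intro ext arg_cong[of _ _ card]) auto

lemma load_Suc:
  "load \<sigma> (Suc i) k = load \<sigma> i k + (if \<exists>\<rho>. path \<sigma> i = Some \<rho> \<and> k \<in> keys (\<sigma> ! i) \<rho> then 1 else 0)"
proof -
  let ?U = "\<lambda>j. \<exists>\<rho>. path \<sigma> j = Some \<rho> \<and> k \<in> keys (\<sigma> ! j) \<rho>"
  have "{j\<in>{..<Suc i}. ?U j} = (if ?U i then insert i {j\<in>{..<i}. ?U j} else {j\<in>{..<i}. ?U j})"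
    by (auto simp: less_Suc_eq)
  then show ?thesis unfolding load_def by simp
qed

lemma load_mono: "i \<le> j \<Longrightarrow> load \<sigma> i k \<le> load \<sigma> j k"
  unfolding load_def by (intro card_mono) auto

text \<open>The load found at acceptance is the rank of the packet among the users of the key, so
  different users have different ranks.\<close>

lemma load_less:
  assumes "i < j" "path \<sigma> i = Some \<rho>" "k \<in> keys (\<sigma> ! i) \<rho>"
  shows "load \<sigma> i k < load \<sigma> j k"
proof -
  have "load \<sigma> (Suc i) k = Suc (load \<sigma> i k)" using assms(2,3) by (simp add: load_Suc)
  then show ?thesis using load_mono[of "Suc i" j \<sigma> k] assms(1) by simp
qed

lemma finite_turns: "finite (turns r \<rho>)"
  by (rule finite_subset[of _ "{..<dx r}"]) (auto simp: turns_def)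

lemma finite_keys: "finite (keys r \<rho>)"
  unfolding keys_def using finite_turns by auto

lemma dx_less: "far r \<Longrightarrow> dx r < n"
  using div_le_dividend[of "dst r" K] unfolding far_def dx_def by linarith

lemma card_keys_le:
  assumes "far r"
  shows "card (keys r \<rho>) \<le> 2 * n"
proof -
  have "card (keys r \<rho>) \<le> card (hkey r \<rho> ` \<rho> ` {sx r..<dx r}) + card (vkey \<rho> ` turns r \<rho>)"
    unfolding keys_def by (rule card_Un_le)
  also have "\<dots> \<le> card {sx r..<dx r} + card (turns r \<rho>)"
    using finite_turns by (intro add_mono order_trans[OF card_image_le] card_image_le) auto
  also have "card (turns r \<rho>) \<le> card {..<dx r}" by (rule card_mono) (auto simp: turns_def)
  finally show ?thesis using dx_less[OF assms] by simp
qed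

section \<open>Exponential weights and weak duality\<close>

lemma weight_nonneg: "0 \<le> weight m" by (simp add: weight_def)

lemma weight_mono: "m \<le> m' \<Longrightarrow> weight m \<le> weight m'"
  unfolding weight_def by (intro divide_right_mono diff_right_mono power_increasing) auto

lemma weight_Suc: "weight (Suc m) = weight m + (weight m + 1 / (2 * real n))"
  using n_pos by (simp add: weight_def field_simps)

lemma weight_L: "1 \<le> weight L"
proof -
  have "real (Suc (2 * n)) \<le> real (2 ^ L)" using L by (intro of_nat_mono) simp
  then show ?thesis using n_pos by (simp add: weight_def field_simps)
qed

text \<open>A key already granted \<open>L\<close> times has weight at least 1 on its own, which
  rules out every sketch using it.\<close>

lemma load_less_L:
  assumes "path \<sigma> i = Some \<rho>" "k \<in> keys (\<sigma> ! i) \<rho>"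
  shows "load \<sigma> i k < L"
proof (rule ccontr)
  assume "\<not> ?thesis"
  then have "1 \<le> weight (load \<sigma> i k)" using weight_mono[of L "load \<sigma> i k"] weight_L by simp
  also have "\<dots> \<le> (\<Sum>k\<in>keys (\<sigma> ! i) \<rho>. weight (load \<sigma> i k))"
    using assms(2) by (intro member_le_sum finite_keys weight_nonneg)
  finally show False using path_SomeD(4)[OF assms(1)] by simp
qed

text \<open>An acceptance adds the old weights of its keys, less than 1 by the admission test, and
  \<open>1 / (2 * n)\<close> for each of at most \<open>2 * n\<close> keys.\<close>

lemma total_weight_le:
  assumes "finite Q"
  shows "(\<Sum>k\<in>Q. weight (load \<sigma> i k)) \<le> 2 * card {j\<in>{..<i}. path \<sigma> j \<noteq> None}"
proof (induction i)
  case 0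
  then show ?case by (simp add: load_def weight_def)
next
  case (Suc i)
  let ?A = "\<lambda>i. {j\<in>{..<i}. path \<sigma> j \<noteq> None}"
  show ?case
  proof (cases "path \<sigma> i")
    case None
    then have "?A (Suc i) = ?A i" by (auto simp: less_Suc_eq)
    then show ?thesis using Suc None by (simp add: load_Suc)
  next
    case (Some \<rho>)
    let ?k = "keys (\<sigma> ! i) \<rho>" and ?w = "\<lambda>k. weight (load \<sigma> i k)"
    have A: "?A (Suc i) = insert i (?A i)" using Some by (auto simp: less_Suc_eq)
    have "weight (load \<sigma> (Suc i) k) = ?w k + (if k \<in> ?k then ?w k + 1 / (2 * real n) else 0)" for k
      using Some by (simp add: load_Suc weight_Suc)
    then have "(\<Sum>k\<in>Q. weight (load \<sigma> (Suc i) k)) = (\<Sum>k\<in>Q. ?w k) + (\<Sum>k\<in>Q. if k \<in> ?k then ?w k + 1 / (2 * real n) else 0)"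
      by (simp add: sum.distrib)
    also have "(\<Sum>k\<in>Q. if k \<in> ?k then ?w k + 1 / (2 * real n) else 0) = (\<Sum>k\<in>Q \<inter> ?k. ?w k + 1 / (2 * real n))"
      using assms by (simp add: sum.inter_restrict)
    also have "\<dots> \<le> (\<Sum>k\<in>?k. ?w k + 1 / (2 * real n))"
      using finite_keys by (intro sum_mono2) (auto intro: add_nonneg_nonneg weight_nonneg)
    also have "\<dots> = (\<Sum>k\<in>?k. ?w k) + card ?k / (2 * real n)" by (simp add: sum.distrib)
    also have "\<dots> \<le> 1 + 1"
      using path_SomeD(1,4)[OF Some] card_keys_le[of "\<sigma> ! i" \<rho>] n_pos by (intro add_mono) auto
    finally show ?thesis using Suc A by simp
  qed
qed

text \<open>A blocked request is charged to the accepted one of its source tile, giving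
  \<open>M\<close>. Any other rejected sketch has total weight at least 1; exchanging the sums lets
  each key be counted at most \<open>M\<close> times, giving \<open>2 * M\<close> by the bound on
  the total weight.\<close>

theorem packing_competitive:
  assumes fin: "finite F" and F: "\<And>i. i \<in> F \<Longrightarrow> i < m \<and> far (\<sigma> ! i) \<and> path \<sigma> i = None \<and> sketch (\<sigma> ! i) (\<rho> i)"
    and tile: "\<And>X R. card {i\<in>F. sx (\<sigma> ! i) = X \<and> sy (\<sigma> ! i) = R} \<le> M"
    and key: "\<And>k. card {i\<in>F. k \<in> keys (\<sigma> ! i) (\<rho> i)} \<le> M"
  shows "card F \<le> 3 * M * card {j\<in>{..<m}. path \<sigma> j \<noteq> None}"
proof -
  let ?A = "{j\<in>{..<m}. path \<sigma> j \<noteq> None}"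
  let ?F1 = "{i\<in>F. blocked \<sigma> i}" and ?F2 = "{i\<in>F. \<not> blocked \<sigma> i}"
  have "?F1 \<subseteq> (\<Union>j\<in>?A. {i\<in>F. sx (\<sigma> ! i) = sx (\<sigma> ! j) \<and> sy (\<sigma> ! i) = sy (\<sigma> ! j)})"
    unfolding blocked_def using F less_trans by fastforce
  then have "card ?F1 \<le> card (\<Union>j\<in>?A. {i\<in>F. sx (\<sigma> ! i) = sx (\<sigma> ! j) \<and> sy (\<sigma> ! i) = sy (\<sigma> ! j)})"
    using fin by (intro card_mono) auto
  also have "\<dots> \<le> (\<Sum>j\<in>?A. card {i\<in>F. sx (\<sigma> ! i) = sx (\<sigma> ! j) \<and> sy (\<sigma> ! i) = sy (\<sigma> ! j)})"
    by (rule card_UN_le) simp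
  also have "\<dots> \<le> (\<Sum>j\<in>?A. M)" by (intro sum_mono tile)
  finally have F1: "card ?F1 \<le> M * card ?A" by (simp add: mult.commute)
  let ?Q = "\<Union>i\<in>?F2. keys (\<sigma> ! i) (\<rho> i)" and ?w = "\<lambda>k. weight (load \<sigma> m k)"
  have finQ: "finite ?Q" using fin finite_keys by auto
  have "real (card ?F2) = (\<Sum>i\<in>?F2. 1)" by simp
  also have "\<dots> \<le> (\<Sum>i\<in>?F2. \<Sum>k\<in>keys (\<sigma> ! i) (\<rho> i). ?w k)"
  proof (rule sum_mono)
    fix i assume "i \<in> ?F2"
    then have i: "i < m" "far (\<sigma> ! i)" "path \<sigma> i = None" "sketch (\<sigma> ! i) (\<rho> i)" "\<not> blocked \<sigma> i" using F by auto
    have "1 \<le> (\<Sum>k\<in>keys (\<sigma> ! i) (\<rho> i). weight (load \<sigma> i k))" using path_NoneD i by blast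
    also have "\<dots> \<le> (\<Sum>k\<in>keys (\<sigma> ! i) (\<rho> i). ?w k)"
      using i(1) by (intro sum_mono weight_mono load_mono) simp
    finally show "1 \<le> (\<Sum>k\<in>keys (\<sigma> ! i) (\<rho> i). ?w k)" .
  qed
  also have "\<dots> = (\<Sum>i\<in>?F2. \<Sum>k\<in>?Q. if k \<in> keys (\<sigma> ! i) (\<rho> i) then ?w k else 0)"
    using finQ by (intro sum.cong refl sum.mono_neutral_cong_left) auto
  also have "\<dots> = (\<Sum>k\<in>?Q. \<Sum>i\<in>?F2. if k \<in> keys (\<sigma> ! i) (\<rho> i) then ?w k else 0)" by (rule sum.swap)
  also have "\<dots> = (\<Sum>k\<in>?Q. ?w k * card {i\<in>?F2. k \<in> keys (\<sigma> ! i) (\<rho> i)})"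
    using fin by (intro sum.cong refl) (simp add: sum.If_cases Int_def mult.commute)
  also have "\<dots> \<le> (\<Sum>k\<in>?Q. ?w k * M)"
  proof (intro sum_mono mult_left_mono weight_nonneg of_nat_mono)
    fix k
    have "card {i\<in>?F2. k \<in> keys (\<sigma> ! i) (\<rho> i)} \<le> card {i\<in>F. k \<in> keys (\<sigma> ! i) (\<rho> i)}"
      using fin by (intro card_mono) auto
    then show "card {i\<in>?F2. k \<in> keys (\<sigma> ! i) (\<rho> i)} \<le> M" using key[of k] by linarith
  qed
  also have "\<dots> = (\<Sum>k\<in>?Q. ?w k) * M" by (simp add: sum_distrib_right)
  also have "\<dots> \<le> real (2 * card ?A) * M"
    by (intro mult_right_mono total_weight_le[OF finQ] of_nat_0_le_iff)
  finally have "real (card ?F2) \<le> real (2 * card ?A * M)" by simp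
  then have F2: "card ?F2 \<le> 2 * card ?A * M" by (simp only: of_nat_le_iff)
  have "F = ?F1 \<union> ?F2" by auto
  then have "card F \<le> card ?F1 + card ?F2" by (metis card_Un_le)
  also have "\<dots> \<le> 3 * M * card ?A" using F1 F2 by (simp add: algebra_simps)
  finally show ?thesis .
qed

lemma run_interval:
  assumes "sketch r \<rho>" "X \<in> run r \<rho> R"
  shows "Min (run r \<rho> R) \<le> X" "X < Suc (Max (run r \<rho> R))" "sx r \<le> Min (run r \<rho> R)" "Suc (Max (run r \<rho> R)) \<le> dx r"
    "Min (run r \<rho> R) \<le> X' \<Longrightarrow> X' < Suc (Max (run r \<rho> R)) \<Longrightarrow> \<rho> X' = R"
proof -
  have fin: "finite (run r \<rho> R)" by (rule finite_subset[of _ "{..<dx r}"]) (auto simp: run_def)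
  show "Min (run r \<rho> R) \<le> X" "X < Suc (Max (run r \<rho> R))" using fin assms(2) by (auto simp: le_imp_less_Suc)
  have m: "Min (run r \<rho> R) \<in> run r \<rho> R" "Max (run r \<rho> R) \<in> run r \<rho> R"
    using fin assms(2) by (auto intro!: Min_in Max_in)
  then show "sx r \<le> Min (run r \<rho> R)" "Suc (Max (run r \<rho> R)) \<le> dx r" by (auto simp: run_def)
  assume X': "Min (run r \<rho> R) \<le> X'" "X' < Suc (Max (run r \<rho> R))"
  have mono: "\<rho> X \<le> \<rho> X'" if "sx r \<le> X" "X \<le> X'" "X' < dx r" for X X'
    using assms(1) that by (auto simp: sketch_def)
  have "\<rho> (Min (run r \<rho> R)) \<le> \<rho> X'" "\<rho> X' \<le> \<rho> (Max (run r \<rho> R))"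
    using X' m mono[of "Min (run r \<rho> R)" X'] mono[of X' "Max (run r \<rho> R)"] by (auto simp: run_def)
  then show "\<rho> X' = R" using m by (auto simp: run_def)
qed

text \<open>Level and anchor name one column inside the run. Packets sharing a key therefore share a
  side of a tile, which is how the load bounds for sketches of a feasible routing bound the use of a
  key.\<close>

lemma hkey_in_keysD:
  assumes "sketch r \<rho>" "(True, R, l, q) \<in> keys r \<rho>"
  shows "sx r \<le> q * 2 ^ l \<and> q * 2 ^ l < dx r \<and> \<rho> (q * 2 ^ l) = R"
proof -
  obtain X where X: "sx r \<le> X" "X < dx r" "(True, R, l, q) = hkey r \<rho> (\<rho> X)"
    using assms(2) by (auto simp: keys_def vkey_def)
  then have R: "R = \<rho> X" by (simp add: hkey_def Let_def)
  then have run: "X \<in> run r \<rho> R" using X by (simp add: run_def)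
  note i = run_interval[OF assms(1) run]
  let ?u = "Min (run r \<rho> R)" and ?v = "Suc (Max (run r \<rho> R))"
  have lq: "l = level ?u ?v" "q = anchor ?u ?v" using X(3) R by (auto simp: hkey_def Let_def)
  have "?u < ?v" using i(1,2) by simp
  note b = anchor_bounds[OF this]
  then show ?thesis using i(3-5) lq by auto
qed

lemma vkey_in_keysD:
  assumes "(False, X, l, q) \<in> keys r \<rho>"
  shows "sx r < X \<and> X < dx r \<and> \<rho> (X - 1) \<le> q * 2 ^ l \<and> q * 2 ^ l < \<rho> X"
  using assms anchor_bounds[of "\<rho> (X - 1)" "\<rho> X"]
  by (auto simp: keys_def vkey_def hkey_def Let_def turns_def)

end

section \<open>Detailed routing inside the tiles\<close>

context line_grid
begin

definition color :: "key \<Rightarrow> nat \<Rightarrow> nat" where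
  "color k s = (case k of (_, _, l, q) \<Rightarrow> (l * 4 + q mod 4) * L + s)"

definition hcol where
  "hcol \<sigma> i \<rho> R = color (hkey (\<sigma> ! i) \<rho> R) (load \<sigma> i (hkey (\<sigma> ! i) \<rho> R))"

definition vcol where
  "vcol \<sigma> i \<rho> X = color (vkey \<rho> X) (load \<sigma> i (vkey \<rho> X))"

text \<open>Inside every tile a horizontal run uses the row, and a vertical run the column, whose offset
  is its color; \<open>edge\<close> is the tile column whose sketch row the packet follows when leaving \<open>x\<close>.\<close>

definition edge where
  "edge \<sigma> i \<rho> x = (if x div K = dx (\<sigma> ! i) \<or> x div K \<in> turns (\<sigma> ! i) \<rho> \<and> x mod K < vcol \<sigma> i \<rho> (x div K)
     then x div K - 1 else x div K)"

definition exit_row where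
  "exit_row \<sigma> i \<rho> x = \<rho> (edge \<sigma> i \<rho> x) * K + hcol \<sigma> i \<rho> (\<rho> (edge \<sigma> i \<rho> x))"

lemma color_less:
  assumes "l < L" "s < L"
  shows "color (d, R, l, q) s < K"
proof -
  have "l * 4 + q mod 4 < L * 4" using assms(1) mod_less_divisor[of 4 q] by linarith
  then have "Suc (l * 4 + q mod 4) * L \<le> L * 4 * L" by (intro mult_le_mono1) simp
  then show ?thesis using assms(2) K_eq by (simp add: color_def)
qed

lemma color_eqD:
  assumes "color (d, R, l, q) s = color (d', R', l', q') s'" "s < L" "s' < L"
  shows "l = l'" "q mod 4 = q' mod 4" "s = s'"
proof -
  let ?m = "l * 4 + q mod 4" and ?m' = "l' * 4 + q' mod 4"
  have eq: "?m * L + s = ?m' * L + s'" using assms(1) by (simp add: color_def)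
  have "(?m * L + s) div L = ?m" "(?m' * L + s') div L = ?m'" using assms(2,3) by simp_all
  then have m: "?m = ?m'" using eq by simp
  then show "s = s'" using eq by simp
  have "?m div 4 = l" "?m' div 4 = l'" by simp_all
  then show "l = l'" using m by simp
  then show "q mod 4 = q' mod 4" using m by simp
qed

lemma hkey_in_keys: "sx r \<le> e \<Longrightarrow> e < dx r \<Longrightarrow> hkey r \<rho> (\<rho> e) \<in> keys r \<rho>"
  by (simp add: keys_def)

lemma vkey_in_keys: "X \<in> turns r \<rho> \<Longrightarrow> vkey \<rho> X \<in> keys r \<rho>"
  by (simp add: keys_def)

context
  fixes \<sigma> :: "request list" and i :: nat and \<rho> :: "nat \<Rightarrow> nat"
  assumes p: "path \<sigma> i = Some \<rho>"
begin

lemma mono_\<rho>: "sx (\<sigma> ! i) \<le> X \<Longrightarrow> X \<le> X' \<Longrightarrow> X' < dx (\<sigma> ! i) \<Longrightarrow> \<rho> X \<le> \<rho> X'"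
  using path_SomeD(3)[OF p] by (simp add: sketch_def)

lemma far_dx: "sx (\<sigma> ! i) + 2 \<le> dx (\<sigma> ! i)"
  using path_SomeD(1)[OF p] by (simp add: far_def)

lemma hcol_less:
  assumes "sx (\<sigma> ! i) \<le> e" "e < dx (\<sigma> ! i)"
  shows "hcol \<sigma> i \<rho> (\<rho> e) < K"
proof -
  have run: "e \<in> run (\<sigma> ! i) \<rho> (\<rho> e)" using assms by (simp add: run_def)
  let ?u = "Min (run (\<sigma> ! i) \<rho> (\<rho> e))" and ?v = "Suc (Max (run (\<sigma> ! i) \<rho> (\<rho> e)))"
  note I = run_interval[OF path_SomeD(3)[OF p] run]
  have "?u < ?v" "?v - ?u < 2 ^ L"
    using I(1-4) dx_less[OF path_SomeD(1)[OF p]] L by linarith+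
  then have "level ?u ?v < L" by (rule level_less)
  then show ?thesis
    using load_less_L[OF p hkey_in_keys[OF assms]] unfolding hcol_def hkey_def Let_def by (rule color_less)
qed

lemma vcol_less:
  assumes "X \<in> turns (\<sigma> ! i) \<rho>"
  shows "vcol \<sigma> i \<rho> X < K"
proof -
  have t: "sx (\<sigma> ! i) < X" "X < dx (\<sigma> ! i)" "\<rho> (X - 1) < \<rho> X" using assms by (auto simp: turns_def)
  have "\<rho> X \<le> \<rho> (dx (\<sigma> ! i) - 1)" using t by (intro mono_\<rho>) auto
  also have "\<dots> \<le> Suc (sy (\<sigma> ! i)) + 2 * n" using path_SomeD(3)[OF p] by (simp add: sketch_def)
  also have "Suc (sy (\<sigma> ! i)) = \<rho> (sx (\<sigma> ! i))" using path_SomeD(3)[OF p] by (simp add: sketch_def)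
  also have "\<dots> \<le> \<rho> (X - 1)" using t by (intro mono_\<rho>) auto
  finally have "\<rho> X - \<rho> (X - 1) < 2 ^ L" using L by linarith
  then have "level (\<rho> (X - 1)) (\<rho> X) < L" by (rule level_less[OF t(3)])
  then show ?thesis
    using load_less_L[OF p vkey_in_keys[OF assms]] unfolding vcol_def vkey_def by (rule color_less)
qed

lemma edge_range:
  assumes "src (\<sigma> ! i) \<le> x" "x < dst (\<sigma> ! i)"
  shows "sx (\<sigma> ! i) \<le> edge \<sigma> i \<rho> x" "edge \<sigma> i \<rho> x < dx (\<sigma> ! i)"
    "edge \<sigma> i \<rho> x \<le> x div K" "x div K \<le> Suc (edge \<sigma> i \<rho> x)"
proof -
  have "sx (\<sigma> ! i) \<le> x div K" unfolding sx_def using assms(1) by (rule div_le_mono)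
  moreover have "x div K \<le> dx (\<sigma> ! i)" unfolding dx_def using assms(2) by (intro div_le_mono) simp
  ultimately show "sx (\<sigma> ! i) \<le> edge \<sigma> i \<rho> x" "edge \<sigma> i \<rho> x < dx (\<sigma> ! i)"
    "edge \<sigma> i \<rho> x \<le> x div K" "x div K \<le> Suc (edge \<sigma> i \<rho> x)"
    using far_dx by (auto simp: edge_def turns_def)
qed

lemma exit_row_div_mod:
  assumes "src (\<sigma> ! i) \<le> x" "x < dst (\<sigma> ! i)"
  shows "exit_row \<sigma> i \<rho> x div K = \<rho> (edge \<sigma> i \<rho> x)"
    "exit_row \<sigma> i \<rho> x mod K = hcol \<sigma> i \<rho> (\<rho> (edge \<sigma> i \<rho> x))"
  using hcol_less[OF edge_range(1,2)[OF assms]] unfolding exit_row_def by simp_all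

lemma exit_row_mono_edge:
  assumes "sx (\<sigma> ! i) \<le> e" "e \<le> e'" "e' < dx (\<sigma> ! i)"
  shows "\<rho> e * K + hcol \<sigma> i \<rho> (\<rho> e) \<le> \<rho> e' * K + hcol \<sigma> i \<rho> (\<rho> e')"
proof (cases "\<rho> e = \<rho> e'")
  case False
  then have "Suc (\<rho> e) \<le> \<rho> e'" using mono_\<rho>[OF assms] by simp
  then have "Suc (\<rho> e) * K \<le> \<rho> e' * K" by (rule mult_le_mono1)
  then show ?thesis using hcol_less[of e] assms by simp
qed simp

text \<open>The row can change only at the color offset of a turn column. On entering a column the
  old row is kept if the column is a turn or the destination; in any other column the sketch has the
  same value as before.\<close>

lemma exit_row_step:
  assumes "src (\<sigma> ! i) \<le> x" "Suc x < dst (\<sigma> ! i)"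
  shows "exit_row \<sigma> i \<rho> (Suc x) = exit_row \<sigma> i \<rho> x \<or>
    edge \<sigma> i \<rho> x = Suc x div K - 1 \<and> edge \<sigma> i \<rho> (Suc x) = Suc x div K \<and>
    Suc x div K \<in> turns (\<sigma> ! i) \<rho> \<and> Suc x mod K = vcol \<sigma> i \<rho> (Suc x div K)"
proof -
  let ?X = "Suc x div K" and ?r = "\<sigma> ! i"
  have Xd: "?X \<le> dx ?r" unfolding dx_def using assms(2) by (intro div_le_mono) simp
  have xs: "sx ?r \<le> x div K" unfolding sx_def using assms(1) by (rule div_le_mono)
  show ?thesis
  proof (cases "Suc x mod K = 0")
    case True
    then have X: "?X = Suc (x div K)" by (simp add: div_Suc)
    have "x mod K = K - 1" using True K_pos by (metis Suc_diff_1 mod_Suc nat.inject nat.simps(3))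
    \<comment> \<open>The last node of a column is never before the turn, since column offsets are
      below \<open>K\<close>.\<close>
    then have "\<not> (x div K \<in> turns ?r \<rho> \<and> x mod K < vcol \<sigma> i \<rho> (x div K))"
      using vcol_less[of "x div K"] by auto
    then have e: "edge \<sigma> i \<rho> x = x div K" using X Xd by (auto simp: edge_def)
    show ?thesis
    proof (cases "?X = dx ?r \<or> ?X \<in> turns ?r \<rho>")
      case False
      then have "\<rho> (x div K) = \<rho> ?X"
        using X Xd xs mono_\<rho>[of "x div K" ?X] by (auto simp: turns_def)
      moreover have "edge \<sigma> i \<rho> (Suc x) = ?X" using False by (auto simp: edge_def)
      ultimately show ?thesis using e by (simp add: exit_row_def)
    next
      case T: True
      show ?thesis
      proof (cases "edge \<sigma> i \<rho> (Suc x) = ?X - 1")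
        case True
        then show ?thesis using e X by (simp add: exit_row_def)
      next
        case False
        then show ?thesis using T e X True by (auto simp: edge_def split: if_splits)
      qed
    qed
  next
    case False
    then have X: "?X = x div K" "Suc x mod K = Suc (x mod K)"
      by (auto simp: div_Suc mod_Suc split: if_splits)
    show ?thesis
    proof (cases "edge \<sigma> i \<rho> (Suc x) = edge \<sigma> i \<rho> x")
      case True
      then show ?thesis by (simp add: exit_row_def)
    next
      case False
      then show ?thesis using X by (auto simp: edge_def split: if_splits)
    qed
  qed
qed

lemma exit_row_le_Suc:
  assumes "src (\<sigma> ! i) \<le> x" "Suc x < dst (\<sigma> ! i)"
  shows "exit_row \<sigma> i \<rho> x \<le> exit_row \<sigma> i \<rho> (Suc x)"
  using exit_row_step[OF assms]
proof
  assume *: "edge \<sigma> i \<rho> x = Suc x div K - 1 \<and> edge \<sigma> i \<rho> (Suc x) = Suc x div K \<and>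
    Suc x div K \<in> turns (\<sigma> ! i) \<rho> \<and> Suc x mod K = vcol \<sigma> i \<rho> (Suc x div K)"
  show ?thesis
    unfolding exit_row_def using * edge_range[of x] edge_range[of "Suc x"] assms
    by (intro exit_row_mono_edge) auto
qed simp

lemma waiting_at_turn:
  assumes "src (\<sigma> ! i) < x" "x < dst (\<sigma> ! i)" "exit_row \<sigma> i \<rho> (x - 1) \<le> h" "h < exit_row \<sigma> i \<rho> x"
  shows "x div K \<in> turns (\<sigma> ! i) \<rho>" "x mod K = vcol \<sigma> i \<rho> (x div K)"
    "\<rho> (x div K - 1) \<le> h div K" "h div K \<le> \<rho> (x div K)"
proof -
  have x: "Suc (x - 1) = x" "src (\<sigma> ! i) \<le> x - 1" "x - 1 < dst (\<sigma> ! i)" using assms(1,2) by auto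
  have *: "edge \<sigma> i \<rho> (x - 1) = x div K - 1 \<and> edge \<sigma> i \<rho> x = x div K \<and>
    x div K \<in> turns (\<sigma> ! i) \<rho> \<and> x mod K = vcol \<sigma> i \<rho> (x div K)"
    using exit_row_step[of "x - 1"] assms x by auto
  then show "x div K \<in> turns (\<sigma> ! i) \<rho>" "x mod K = vcol \<sigma> i \<rho> (x div K)" by auto
  show "\<rho> (x div K - 1) \<le> h div K"
    using div_le_mono[OF assms(3), of K] exit_row_div_mod(1)[of "x - 1"] * x by simp
  show "h div K \<le> \<rho> (x div K)"
    using div_le_mono[OF less_imp_le[OF assms(4)], of K] exit_row_div_mod(1)[of x] * assms by simp
qed

text \<open>Starting one tile row higher makes the first row of the path lie above the source row
  whatever its offset is; the initial wait then meets only two tile rows.\<close>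

lemma exit_row_src:
  shows "row0 n (\<sigma> ! i) \<le> exit_row \<sigma> i \<rho> (src (\<sigma> ! i))"
    and "row0 n (\<sigma> ! i) \<le> h \<Longrightarrow> h < exit_row \<sigma> i \<rho> (src (\<sigma> ! i)) \<Longrightarrow>
      sy (\<sigma> ! i) = h div K \<or> Suc (sy (\<sigma> ! i)) = h div K"
proof -
  let ?r = "\<sigma> ! i"
  have "sx ?r < dx ?r" using far_dx by simp
  then have s: "src ?r < dst ?r" using div_le_mono[of "dst ?r" "src ?r" K] by (force simp: sx_def dx_def)
  have "edge \<sigma> i \<rho> (src ?r) = sx ?r"
    using far_dx by (auto simp: edge_def sx_def[symmetric] turns_def)
  then have d: "exit_row \<sigma> i \<rho> (src ?r) div K = Suc (sy ?r)"
    using exit_row_div_mod(1)[of "src ?r"] s path_SomeD(3)[OF p] by (simp add: sketch_def)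
  have "row0 n ?r < Suc (sy ?r) * K" using tile_bounds(2)[OF K_pos, of "row0 n ?r"] by (simp add: sy_def)
  also have "\<dots> \<le> exit_row \<sigma> i \<rho> (src ?r)" using tile_bounds(1)[OF K_pos] d by metis
  finally show "row0 n ?r \<le> exit_row \<sigma> i \<rho> (src ?r)" by simp
  assume "row0 n ?r \<le> h" "h < exit_row \<sigma> i \<rho> (src ?r)"
  then have "sy ?r \<le> h div K" "h div K \<le> Suc (sy ?r)"
    using div_le_mono[of "row0 n ?r" h K] div_le_mono[of h "exit_row \<sigma> i \<rho> (src ?r)" K] d by (auto simp: sy_def)
  then show "sy ?r = h div K \<or> Suc (sy ?r) = h div K" by linarith
qed

lemma exit_row_in_time:
  "enat (exit_row \<sigma> i \<rho> (dst (\<sigma> ! i) - 1) + dst (\<sigma> ! i)) \<le> ddl (\<sigma> ! i) + enat n"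
proof -
  let ?r = "\<sigma> ! i"
  have "sx ?r < dx ?r" using far_dx by simp
  then have "src ?r < dst ?r" using div_le_mono[of "dst ?r" "src ?r" K] by (force simp: sx_def dx_def)
  then have s: "src ?r \<le> dst ?r - 1" "dst ?r - 1 < dst ?r" by auto
  note e = edge_range[OF s]
  have "\<rho> (edge \<sigma> i \<rho> (dst ?r - 1)) \<le> \<rho> (dx ?r - 1)" using e by (intro mono_\<rho>) auto
  then have "exit_row \<sigma> i \<rho> (dst ?r - 1) \<le> \<rho> (dx ?r - 1) * K + K - 1"
    using hcol_less[OF e(1,2)] mult_le_mono1[of "\<rho> (edge \<sigma> i \<rho> (dst ?r - 1))" "\<rho> (dx ?r - 1)" K]
    unfolding exit_row_def by linarith
  then have "enat (exit_row \<sigma> i \<rho> (dst ?r - 1) + dst ?r) \<le> enat (\<rho> (dx ?r - 1) * K + K - 1 + dst ?r)" by simp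
  also have "\<dots> \<le> ddl ?r + enat n"
    using path_SomeD(3)[OF p] by (simp add: sketch_def in_time_def)
  finally show ?thesis .
qed

end

text \<open>A packet in tile column \<open>X\<close> may follow its run into or out of that column,
  so the two runs need not overlap but only touch at \<open>X\<close>. Closed intervals in
  \<open>anchor_eq\<close> cover this.\<close>

lemma hkey_collision:
  assumes "sketch r \<rho>" "sketch r' \<rho>'" and e: "sx r \<le> e" "e < dx r" "sx r' \<le> e'" "e' < dx r'"
    and R: "\<rho> e = R" "\<rho>' e' = R" and X: "e \<le> X" "X \<le> Suc e" "e' \<le> X" "X \<le> Suc e'"
    and c: "color (hkey r \<rho> R) s = color (hkey r' \<rho>' R) s'" "s < L" "s' < L"
  shows "hkey r \<rho> R = hkey r' \<rho>' R" "s = s'"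
proof -
  have run: "e \<in> run r \<rho> R" "e' \<in> run r' \<rho>' R" using e R by (auto simp: run_def)
  note I = run_interval(1,2)[OF assms(1) run(1)] and I' = run_interval(1,2)[OF assms(2) run(2)]
  let ?u = "Min (run r \<rho> R)" and ?v = "Suc (Max (run r \<rho> R))"
  let ?u' = "Min (run r' \<rho>' R)" and ?v' = "Suc (Max (run r' \<rho>' R))"
  note D = color_eqD[OF c[unfolded hkey_def Let_def]]
  have "anchor ?u ?v = anchor ?u' ?v'"
    by (rule anchor_eq[where z = X]) (use I I' X D in linarith)+
  with D show "hkey r \<rho> R = hkey r' \<rho>' R" "s = s'" by (simp_all add: hkey_def Let_def)
qed

text \<open>Equal rows mean equal tile row and equal offset, hence equal colors of touching runs. So
  the packets use the same key with the same rank.\<close>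

lemma exit_row_inj:
  assumes p: "path \<sigma> i = Some \<rho>" "path \<sigma> j = Some \<rho>'"
    and x: "src (\<sigma> ! i) \<le> x" "x < dst (\<sigma> ! i)" "src (\<sigma> ! j) \<le> x" "x < dst (\<sigma> ! j)"
    and h: "exit_row \<sigma> i \<rho> x = exit_row \<sigma> j \<rho>' x"
  shows "i = j"
proof -
  note e = edge_range[OF p(1) x(1,2)] and e' = edge_range[OF p(2) x(3,4)]
  note d = exit_row_div_mod[OF p(1) x(1,2)] and d' = exit_row_div_mod[OF p(2) x(3,4)]
  let ?R = "\<rho> (edge \<sigma> i \<rho> x)"
  let ?k = "hkey (\<sigma> ! i) \<rho> ?R" and ?k' = "hkey (\<sigma> ! j) \<rho>' ?R"
  have R: "\<rho>' (edge \<sigma> j \<rho>' x) = ?R" using d(1) d'(1) h by simp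
  have k: "?k \<in> keys (\<sigma> ! i) \<rho>" "?k' \<in> keys (\<sigma> ! j) \<rho>'"
    using hkey_in_keys[OF e(1,2), of \<rho>] hkey_in_keys[OF e'(1,2), of \<rho>'] by (simp_all add: R)
  have "color ?k (load \<sigma> i ?k) = color ?k' (load \<sigma> j ?k')"
    using d(2) d'(2) h R by (simp add: hcol_def)
  from hkey_collision[OF path_SomeD(3)[OF p(1)] path_SomeD(3)[OF p(2)] e(1,2) e'(1,2) refl R
      e(3,4) e'(3,4) this load_less_L[OF p(1) k(1)] load_less_L[OF p(2) k(2)]]
  have "?k = ?k'" "load \<sigma> i ?k = load \<sigma> j ?k'" .
  then show ?thesis
    using load_less[of i j, OF _ p(1) k(1)] load_less[of j i, OF _ p(2) k(2)] by (metis less_irrefl linorder_neqE_nat)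
qed

text \<open>The vertical counterpart: the shared node gives the tile column and its offset, and both
  climbs touch tile row \<open>h div K\<close>.\<close>

lemma waiting_inj:
  assumes p: "path \<sigma> i = Some \<rho>" "path \<sigma> j = Some \<rho>'"
    and i: "src (\<sigma> ! i) < x" "x < dst (\<sigma> ! i)" "exit_row \<sigma> i \<rho> (x - 1) \<le> h" "h < exit_row \<sigma> i \<rho> x"
    and j: "src (\<sigma> ! j) < x" "x < dst (\<sigma> ! j)" "exit_row \<sigma> j \<rho>' (x - 1) \<le> h" "h < exit_row \<sigma> j \<rho>' x"
  shows "i = j"
proof -
  note w = waiting_at_turn[OF p(1) i] and w' = waiting_at_turn[OF p(2) j]
  let ?X = "x div K"
  note k = vkey_in_keys[OF w(1)] and k' = vkey_in_keys[OF w'(1)]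
  have "color (vkey \<rho> ?X) (load \<sigma> i (vkey \<rho> ?X)) = color (vkey \<rho>' ?X) (load \<sigma> j (vkey \<rho>' ?X))"
    using w(2) w'(2) by (simp add: vcol_def)
  note D = color_eqD[OF this[unfolded vkey_def] load_less_L[OF p(1) k, unfolded vkey_def]
      load_less_L[OF p(2) k', unfolded vkey_def]]
  have "\<rho> (?X - 1) < \<rho> ?X" "\<rho>' (?X - 1) < \<rho>' ?X" using w(1) w'(1) by (auto simp: turns_def)
  then have "anchor (\<rho> (?X - 1)) (\<rho> ?X) = anchor (\<rho>' (?X - 1)) (\<rho>' ?X)"
    by (rule anchor_eq[where z = "h div K"]) (use w w' D in auto)
  then have "vkey \<rho> ?X = vkey \<rho>' ?X" "load \<sigma> i (vkey \<rho> ?X) = load \<sigma> j (vkey \<rho>' ?X)"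
    using D by (simp_all add: vkey_def)
  then show ?thesis
    using load_less[of i j, OF _ p(1) k] load_less[of j i, OF _ p(2) k'] by (metis less_irrefl linorder_neqE_nat)
qed

lemma start_tile_inj:
  assumes "path \<sigma> i = Some \<rho>" "path \<sigma> j = Some \<rho>'"
    and "sx (\<sigma> ! i) = sx (\<sigma> ! j)" "sy (\<sigma> ! i) = sy (\<sigma> ! j)"
  shows "i = j"
  using path_SomeD(2)[OF assms(1)] path_SomeD(2)[OF assms(2)] assms
  unfolding blocked_def by (metis linorder_neqE_nat option.distinct(1))

end

section \<open>The online routing\<close>

lemma path_system_subset:
  assumes "path_system c B I a b y Y" "J \<subseteq> I"
  shows "path_system c B J a b y Y"
proof -
  note P = assms(1)[unfolded path_system_def]
  have fin: "finite I" using P by blast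
  have sub: "card {i\<in>J. P i} \<le> card {i\<in>I. P i}" for P
    using fin assms(2) by (intro card_mono) auto
  show ?thesis
    unfolding path_system_def
  proof (intro conjI ballI allI impI)
    show "finite J" using fin assms(2) by (rule finite_subset[rotated])
  next
    fix i x assume "i \<in> J" "a i \<le> x \<and> x < b i"
    then show "wait_from (a i) (y i) (Y i) x \<le> Y i x" using P assms(2) by blast
  next
    fix x h
    show "card {i\<in>J. a i \<le> x \<and> x < b i \<and> Y i x = h} \<le> c" using P by (intro order_trans[OF sub]) blast
    show "card {i\<in>J. a i \<le> x \<and> x < b i \<and> wait_from (a i) (y i) (Y i) x \<le> h \<and> h < Y i x} \<le> B"
      using P by (intro order_trans[OF sub]) blast
  qed
qed

lemma card_le_Suc0I:
  assumes "\<And>i j. i \<in> S \<Longrightarrow> j \<in> S \<Longrightarrow> i = j"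
  shows "card S \<le> Suc 0"
proof (cases "finite S")
  case True
  then show ?thesis using assms by (subst card_le_Suc0_iff_eq) blast+
qed simp

lemma loc_cong:
  assumes "\<And>\<theta>. rel (\<sigma> ! i) \<le> \<theta> \<Longrightarrow> A i \<theta> = A' i \<theta>"
  shows "loc \<sigma> A i \<tau> = loc \<sigma> A' i \<tau>"
proof (induction \<tau>)
  case (Suc \<tau>)
  then show ?case using assms[of \<tau>] loc_ge[of \<sigma> A' i \<tau>] by (auto split: option.splits)
qed simp

lemma loc_rel_le: "loc \<sigma> A i \<tau> = Some v \<Longrightarrow> rel (\<sigma> ! i) \<le> \<tau>"
  using loc_ge by blast

lemma feasible_cong:
  assumes "\<And>i \<theta>. i < length \<sigma> \<Longrightarrow> rel (\<sigma> ! i) \<le> \<theta> \<Longrightarrow> A i \<theta> = A' i \<theta>"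
  shows "feasible c B \<sigma> A = feasible c B \<sigma> A'"
proof -
  have "{i. i < length \<sigma> \<and> loc \<sigma> A i \<tau> = Some v \<and> v \<noteq> dst (\<sigma> ! i) \<and> A i \<tau> = d} =
        {i. i < length \<sigma> \<and> loc \<sigma> A' i \<tau> = Some v \<and> v \<noteq> dst (\<sigma> ! i) \<and> A' i \<tau> = d}" for v \<tau> d
    using loc_cong[of \<sigma> _ A A'] assms loc_rel_le by (intro Collect_cong) metis
  then show ?thesis by (simp add: feasible_def)
qed

lemma throughput_cong:
  assumes "\<And>i \<theta>. i < length \<sigma> \<Longrightarrow> rel (\<sigma> ! i) \<le> \<theta> \<Longrightarrow> A i \<theta> = A' i \<theta>"
  shows "throughput \<sigma> A = throughput \<sigma> A'"
proof -
  have "{i. i < length \<sigma> \<and> delivered \<sigma> A i} = {i. i < length \<sigma> \<and> delivered \<sigma> A' i}"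
    using loc_cong[of \<sigma> _ A A'] assms unfolding delivered_def by (intro Collect_cong) metis
  then show ?thesis by (simp add: throughput_def)
qed

text \<open>\<open>Max\<close> is only meaningful on a finite nonempty set: the bound gives
  finiteness and \<open>A0\<close> nonemptiness.\<close>

lemma opt_le:
  assumes "feasible c B \<sigma> A0" "\<And>A. feasible c B \<sigma> A \<Longrightarrow> throughput \<sigma> A \<le> m"
  shows "opt c B \<sigma> \<le> m"
proof -
  let ?T = "{throughput \<sigma> A | A. feasible c B \<sigma> A}"
  have "t \<le> m" if "t \<in> ?T" for t using that assms(2) by blast
  moreover then have "finite ?T" by (intro finite_subset[of ?T "{..m}"]) (simp_all add: subset_iff)
  moreover have "?T \<noteq> {}" using assms(1) by blast
  ultimately show ?thesis unfolding opt_def by (intro Max.boundedI)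
qed

lemma revealed_eq_take:
  assumes "valid_input n \<sigma>"
  obtains m where "revealed \<sigma> \<tau> = take m \<sigma>" "m \<le> length \<sigma>"
    "\<And>i. i < length \<sigma> \<Longrightarrow> rel (\<sigma> ! i) \<le> \<tau> \<longleftrightarrow> i < m"
proof
  let ?P = "\<lambda>r. rel r \<le> \<tau>" let ?m = "length (takeWhile ?P \<sigma>)"
  show "revealed \<sigma> \<tau> = take ?m \<sigma>" unfolding revealed_def by (rule takeWhile_eq_take)
  show "?m \<le> length \<sigma>" by (rule length_takeWhile_le)
  fix i assume i: "i < length \<sigma>"
  have "i < ?m" if "rel (\<sigma> ! i) \<le> \<tau>"
  proof (rule ccontr)
    assume "\<not> i < ?m"
    then have m: "?m \<le> i" "?m < length \<sigma>" using i by auto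
    have "rel (\<sigma> ! ?m) \<le> rel (\<sigma> ! i)"
      using assms m(1) i sorted_nth_mono[of "map rel \<sigma>" ?m i] by (simp add: valid_input_def)
    then show False using nth_length_takeWhile[OF m(2)] that by simp
  qed
  moreover have "rel (\<sigma> ! i) \<le> \<tau>" if "i < ?m"
    using set_takeWhileD[OF nth_mem[OF that]] takeWhile_nth[OF that] by simp
  ultimately show "rel (\<sigma> ! i) \<le> \<tau> \<longleftrightarrow> i < ?m" by blast
qed

context line_grid
begin

definition straight :: "request \<Rightarrow> bool" where
  "straight r \<longleftrightarrow> \<not> far r \<and> src r < dst r \<and> enat (rel r + (dst r - src r)) \<le> ddl r"

definition entering :: "request list \<Rightarrow> nat \<Rightarrow> nat \<Rightarrow> nat set" where
  "entering \<sigma> h x = {i. i < length \<sigma> \<and> straight (\<sigma> ! i) \<and> row0 n (\<sigma> ! i) = h \<and> src (\<sigma> ! i) = x}"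

definition row_win :: "request list \<Rightarrow> nat \<Rightarrow> nat \<Rightarrow> nat option" where
  "row_win \<sigma> h = win (\<lambda>i. dst (\<sigma> ! i)) (entering \<sigma> h)"

text \<open>A packet without sketch is never stored, so its position is known from its age and no
  reference to \<open>loc\<close> is required.\<close>

definition routing :: "request list \<Rightarrow> nat \<Rightarrow> nat \<Rightarrow> action" where
  "routing \<sigma> i \<tau> = (case path \<sigma> i of
      Some \<rho> \<Rightarrow> (if \<exists>x. src (\<sigma> ! i) \<le> x \<and> x < dst (\<sigma> ! i) \<and> exit_row \<sigma> i \<rho> x + x = \<tau> + n then Forward else Keep)
    | None \<Rightarrow> (if straight (\<sigma> ! i) \<and> rel (\<sigma> ! i) \<le> \<tau> \<and>
          row_win \<sigma> (row0 n (\<sigma> ! i)) (src (\<sigma> ! i) + (\<tau> - rel (\<sigma> ! i))) = Some i then Forward else Delete))"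

text \<open>Restricting to the revealed prefix makes this online by construction; the work lies in
  showing that it agrees with \<open>routing\<close> on the whole input.\<close>

definition online_routing :: algorithm where
  "online_routing \<sigma> i \<tau> = routing (revealed \<sigma> \<tau>) i \<tau>"

lemma online_online_routing: "online n online_routing"
  by (simp add: online_def online_routing_def)

lemma row_packing_entering:
  "row_packing (\<lambda>i. src (\<sigma> ! i)) (\<lambda>i. dst (\<sigma> ! i)) (entering \<sigma> h)"
  by standard (auto simp: entering_def straight_def)

lemma exit_row_take:
  assumes "m \<le> length \<sigma>" "i < m"
  shows "exit_row (take m \<sigma>) i \<rho> = exit_row \<sigma> i \<rho>"
  using assms(2)
  by (intro ext) (simp add: exit_row_def edge_def hcol_def vcol_def load_take[OF assms(1) less_imp_le[OF assms(2)]])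

text \<open>For the straight packets: one that enters row \<open>h\<close> at a node
  \<open>z\<close> is released at step \<open>h + z - n\<close>. For \<open>z\<close> up to the
  current node this is at most \<open>\<tau>\<close>, so all competitors so far are
  revealed.\<close>

lemma routing_revealed:
  assumes v: "valid_input n \<sigma>" and i: "i < length \<sigma>" "rel (\<sigma> ! i) \<le> \<tau>"
  shows "routing (revealed \<sigma> \<tau>) i \<tau> = routing \<sigma> i \<tau>"
proof -
  obtain m where m: "revealed \<sigma> \<tau> = take m \<sigma>" "m \<le> length \<sigma>"
    "\<And>i. i < length \<sigma> \<Longrightarrow> rel (\<sigma> ! i) \<le> \<tau> \<longleftrightarrow> i < m"
    using revealed_eq_take[OF v] by metis
  have im: "i < m" using m(3) i by simp
  let ?r = "\<sigma> ! i" let ?h = "row0 n ?r" and ?x = "src ?r + (\<tau> - rel ?r)"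
  have row: "row0 n (\<sigma> ! j) + src (\<sigma> ! j) = rel (\<sigma> ! j) + n" if "j < length \<sigma>" for j
  proof -
    have "src (\<sigma> ! j) \<le> dst (\<sigma> ! j) \<and> dst (\<sigma> ! j) < n" using v that by (simp add: valid_input_def)
    then show ?thesis by (simp add: row0_def)
  qed
  have "entering (take m \<sigma>) ?h z = entering \<sigma> ?h z" if "z \<le> ?x" for z
  proof -
    have "j < m" if "j \<in> entering \<sigma> ?h z" for j
    proof -
      have j: "j < length \<sigma>" "row0 n (\<sigma> ! j) = ?h" "src (\<sigma> ! j) = z" using that by (auto simp: entering_def)
      then have "rel (\<sigma> ! j) \<le> \<tau>" using row[OF j(1)] row[OF i(1)] \<open>z \<le> ?x\<close> i(2) by linarith
      then show ?thesis using m(3) j by simp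
    qed
    then show ?thesis using m(2) by (auto simp: entering_def)
  qed
  moreover have "finite (entering (take m \<sigma>) ?h z)" for z by (simp add: entering_def)
  moreover have "dst (take m \<sigma> ! j) = dst (\<sigma> ! j)" if "j \<in> entering (take m \<sigma>) ?h z" for j z
    using that by (auto simp: entering_def)
  ultimately have "row_win (take m \<sigma>) ?h ?x = row_win \<sigma> ?h ?x"
    using win_cong[of ?x "entering (take m \<sigma>) ?h" "entering \<sigma> ?h" "\<lambda>i. dst (take m \<sigma> ! i)" "\<lambda>i. dst (\<sigma> ! i)"]
    unfolding row_win_def by blast
  then show ?thesis
    by (simp only: m(1) routing_def path_take[OF m(2) im] exit_row_take[OF m(2) im] nth_take[OF im])
qed

context
  fixes \<sigma> :: "request list"
  assumes valid: "valid_input n \<sigma>"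
begin

abbreviation "loc\<^sub>r \<equiv> loc \<sigma> (routing \<sigma>)"

lemma bounds: "i < length \<sigma> \<Longrightarrow> src (\<sigma> ! i) \<le> dst (\<sigma> ! i) \<and> dst (\<sigma> ! i) < n"
  using valid by (simp add: valid_input_def)

lemma row0_eq: "i < length \<sigma> \<Longrightarrow> row0 n (\<sigma> ! i) + src (\<sigma> ! i) = rel (\<sigma> ! i) + n"
  using bounds[of i] by (simp add: row0_def)

lemma exit_row_ge_rel:
  assumes "path \<sigma> i = Some \<rho>" "i < length \<sigma>" "src (\<sigma> ! i) \<le> x" "x < dst (\<sigma> ! i)"
  shows "rel (\<sigma> ! i) + n \<le> exit_row \<sigma> i \<rho> x + x"
proof -
  have "x < dst (\<sigma> ! i) \<longrightarrow> exit_row \<sigma> i \<rho> (src (\<sigma> ! i)) \<le> exit_row \<sigma> i \<rho> x"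
    using assms(3)
  proof (induction rule: dec_induct)
    case (step x)
    then show ?case using exit_row_le_Suc[OF assms(1), of x] by auto
  qed simp
  then show ?thesis using exit_row_src(1)[OF assms(1)] row0_eq[OF assms(2)] assms(3,4) by linarith
qed

lemma sketched_packet:
  assumes p: "path \<sigma> i = Some \<rho>" and i: "i < length \<sigma>"
  shows "delivered \<sigma> (routing \<sigma>) i"
    and "loc\<^sub>r i \<tau> = Some v \<Longrightarrow> v \<noteq> dst (\<sigma> ! i) \<Longrightarrow> src (\<sigma> ! i) \<le> v \<and> v < dst (\<sigma> ! i) \<and>
      (routing \<sigma> i \<tau> = Forward \<longrightarrow> exit_row \<sigma> i \<rho> v = \<tau> + n - v) \<and>
      (routing \<sigma> i \<tau> = Keep \<longrightarrow> wait_from (src (\<sigma> ! i)) (row0 n (\<sigma> ! i)) (exit_row \<sigma> i \<rho>) v \<le> \<tau> + n - v \<and>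
         \<tau> + n - v < exit_row \<sigma> i \<rho> v)"
proof -
  let ?r = "\<sigma> ! i" and ?Y = "exit_row \<sigma> i \<rho>"
  \<comment> \<open>Rows turned back into times; \<open>exit_row_ge_rel\<close> excludes
    truncation.\<close>
  define T where "T x = ?Y x + x - n" for x
  note b = bounds[OF i] and ge = exit_row_ge_rel[OF p i]
  have lt: "src ?r < dst ?r"
    using far_dx[OF p] div_le_mono[of "dst ?r" "src ?r" K] by (force simp: sx_def dx_def)
  have w: "wait_from (src ?r) (rel ?r) (\<lambda>x. Suc (T x)) x + n = wait_from (src ?r) (row0 n ?r) ?Y x + x"
    if "src ?r \<le> x" "x \<le> dst ?r" for x
  proof (cases "x = src ?r")
    case False
    then have "rel ?r + n \<le> ?Y (x - 1) + (x - 1)" "1 \<le> x" using that ge[of "x - 1"] by auto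
    then show ?thesis using False by (simp add: wait_from_def T_def)
  qed (simp add: wait_from_def row0_eq[OF i])
  have wY: "wait_from (src ?r) (row0 n ?r) ?Y x \<le> ?Y x" if "src ?r \<le> x" "x < dst ?r" for x
    using that exit_row_src(1)[OF p] exit_row_le_Suc[OF p, of "x - 1"] by (auto simp: wait_from_def)
  have T: "wait_from (src ?r) (rel ?r) (\<lambda>x. Suc (T x)) x \<le> T x" if "src ?r \<le> x" "x < dst ?r" for x
    using w[of x] wY[of x] ge[of x] that unfolding T_def by simp
  have D: "routing \<sigma> i \<tau> \<noteq> Delete" for \<tau> using p by (simp add: routing_def)
  have F: "routing \<sigma> i \<tau> = Forward \<longleftrightarrow> (\<exists>x. src ?r \<le> x \<and> x < dst ?r \<and> T x = \<tau>)" for \<tau>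
  proof -
    have "T x = \<tau> \<longleftrightarrow> ?Y x + x = \<tau> + n" if "src ?r \<le> x" "x < dst ?r" for x
      using ge[OF that] unfolding T_def by linarith
    then show ?thesis using p by (auto simp: routing_def)
  qed
  let ?t = "wait_from (src ?r) (rel ?r) (\<lambda>x. Suc (T x)) (dst ?r)"
  have "?t + n = ?Y (dst ?r - 1) + dst ?r" using w[of "dst ?r"] lt by (simp add: wait_from_def)
  then have "enat (?t + n) \<le> ddl ?r + enat n" using exit_row_in_time[OF p] by simp
  then have "enat ?t \<le> ddl ?r" by (cases "ddl ?r") auto
  moreover have "loc\<^sub>r i ?t = Some (dst ?r)"
    by (rule loc_follows_times(2)[where T = T and A = "routing \<sigma>" and \<sigma> = \<sigma> and i = i, OF conjunct1[OF b] _ D F]) (rule T)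
  ultimately show "delivered \<sigma> (routing \<sigma>) i" unfolding delivered_def by blast
  assume v: "loc\<^sub>r i \<tau> = Some v" "v \<noteq> dst ?r"
  have f: "src ?r \<le> v \<and> v \<le> dst ?r \<and> wait_from (src ?r) (rel ?r) (\<lambda>x. Suc (T x)) v \<le> \<tau> \<and>
      (v < dst ?r \<longrightarrow> \<tau> \<le> T v \<and> (routing \<sigma> i \<tau> = Forward \<longleftrightarrow> \<tau> = T v))"
    by (rule loc_follows_times(1)[where T = T and A = "routing \<sigma>" and \<sigma> = \<sigma> and i = i, OF conjunct1[OF b] _ D F v(1)]) (rule T)
  then have vb: "src ?r \<le> v" "v < dst ?r" using v(2) by auto
  then show "src ?r \<le> v \<and> v < dst ?r \<and>
      (routing \<sigma> i \<tau> = Forward \<longrightarrow> ?Y v = \<tau> + n - v) \<and>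
      (routing \<sigma> i \<tau> = Keep \<longrightarrow> wait_from (src ?r) (row0 n ?r) ?Y v \<le> \<tau> + n - v \<and> \<tau> + n - v < ?Y v)"
    using f w[of v] ge[of v] b by (auto simp: T_def)
qed

lemma unsketched_packet:
  assumes p: "path \<sigma> i = None" and l: "loc\<^sub>r i \<tau> = Some v"
  shows "rel (\<sigma> ! i) \<le> \<tau> \<and> v = src (\<sigma> ! i) + (\<tau> - rel (\<sigma> ! i))"
  using l
proof (induction \<tau> arbitrary: v)
  case 0
  then show ?case by (simp split: if_splits)
next
  case (Suc \<tau>)
  show ?case
  proof (cases "rel (\<sigma> ! i) = Suc \<tau>")
    case True
    then show ?thesis using Suc.prems by simp
  next
    case False
    obtain u where u: "loc\<^sub>r i \<tau> = Some u" "routing \<sigma> i \<tau> = Forward \<and> v = Suc u \<or> routing \<sigma> i \<tau> = Keep \<and> v = u"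
      using loc_SucD[OF Suc.prems False] by metis
    have "routing \<sigma> i \<tau> \<noteq> Keep" using p by (simp add: routing_def)
    then show ?thesis using u Suc.IH[OF u(1)] by auto
  qed
qed

lemma straight_not_far: "straight r \<Longrightarrow> \<not> far r" by (simp add: straight_def)

lemma not_far_path: "\<not> far (\<sigma> ! i) \<Longrightarrow> path \<sigma> i = None"
  using path_SomeD(1) by (cases "path \<sigma> i") auto

lemma straight_delivered:
  assumes i: "i \<in> entering \<sigma> h (src (\<sigma> ! i))"
    and w: "\<And>z. src (\<sigma> ! i) \<le> z \<Longrightarrow> z < dst (\<sigma> ! i) \<Longrightarrow> row_win \<sigma> h z = Some i"
  shows "delivered \<sigma> (routing \<sigma>) i"
proof -
  let ?r = "\<sigma> ! i"
  have s: "straight ?r" "row0 n ?r = h" using i by (auto simp: entering_def)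
  have p: "path \<sigma> i = None" using s not_far_path straight_not_far by blast
  have "x \<le> dst ?r \<longrightarrow> loc\<^sub>r i (rel ?r + (x - src ?r)) = Some x" if "src ?r \<le> x" for x
    using that
  proof (induction rule: dec_induct)
    case base
    then show ?case by (simp add: loc_rel)
  next
    case (step x)
    show ?case
    proof
      assume "Suc x \<le> dst ?r"
      then have l: "loc\<^sub>r i (rel ?r + (x - src ?r)) = Some x" "x < dst ?r" using step by auto
      have "row_win \<sigma> h x = Some i" using w[of x] step l by simp
      then have "routing \<sigma> i (rel ?r + (x - src ?r)) = Forward"
        using p s step by (simp add: routing_def)
      then show "loc\<^sub>r i (rel ?r + (Suc x - src ?r)) = Some (Suc x)"
        using l step by (simp add: Suc_diff_le)
    qed
  qed
  then have "loc\<^sub>r i (rel ?r + (dst ?r - src ?r)) = Some (dst ?r)" using s by (simp add: straight_def)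
  then show ?thesis using s unfolding delivered_def straight_def by blast
qed

text \<open>A link carries at most one sketched packet and one row winner. Only sketched packets are
  stored: one in the middle of its path, and one for each of the two possible tile rows of a source
  at this node.\<close>

lemma routing_feasible:
  assumes "3 \<le> c" "3 \<le> B"
  shows "feasible c B \<sigma> (routing \<sigma>)"
  unfolding feasible_def
proof (intro allI conjI)
  fix v \<tau>
  let ?S = "\<lambda>d. {i. i < length \<sigma> \<and> loc\<^sub>r i \<tau> = Some v \<and> v \<noteq> dst (\<sigma> ! i) \<and> routing \<sigma> i \<tau> = d}"
  let ?h = "\<tau> + n - v"
  let ?A = "{i\<in>?S Forward. path \<sigma> i \<noteq> None}" and ?W = "{i\<in>?S Forward. path \<sigma> i = None}"
  have "i = j" if "i \<in> ?A" "j \<in> ?A" for i j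
  proof -
    have "path \<sigma> i \<noteq> None" "path \<sigma> j \<noteq> None" using that by simp_all
    then obtain \<rho> \<rho>' where p: "path \<sigma> i = Some \<rho>" "path \<sigma> j = Some \<rho>'" by blast
    have "src (\<sigma> ! i) \<le> v" "v < dst (\<sigma> ! i)" "exit_row \<sigma> i \<rho> v = ?h"
      "src (\<sigma> ! j) \<le> v" "v < dst (\<sigma> ! j)" "exit_row \<sigma> j \<rho>' v = ?h"
      using that sketched_packet(2)[OF p(1), of \<tau> v] sketched_packet(2)[OF p(2), of \<tau> v] by auto
    then show ?thesis using exit_row_inj[OF p] by simp
  qed
  then have A: "card ?A \<le> Suc 0" by (rule card_le_Suc0I)
  have win: "row_win \<sigma> ?h v = Some i" if "i \<in> ?W" for i
  proof -
    have u: "i < length \<sigma>" "rel (\<sigma> ! i) \<le> \<tau>" "v = src (\<sigma> ! i) + (\<tau> - rel (\<sigma> ! i))"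
      using that unsketched_packet[of i \<tau> v] by auto
    then have "row0 n (\<sigma> ! i) = ?h" using row0_eq[OF u(1)] by linarith
    then show ?thesis using that u by (auto simp: routing_def split: if_splits)
  qed
  have "i = j" if "i \<in> ?W" "j \<in> ?W" for i j using win[OF that(1)] win[OF that(2)] by simp
  then have W: "card ?W \<le> Suc 0" by (rule card_le_Suc0I)
  have split: "S = {i\<in>S. P i} \<union> {i\<in>S. \<not> P i}" for S :: "nat set" and P by blast
  have "card (?S Forward) = card (?W \<union> ?A)" by (intro arg_cong[of _ _ card] split)
  also have "\<dots> \<le> card ?W + card ?A" by (rule card_Un_le)
  finally show "card (?S Forward) \<le> c" using A W assms(1) by linarith
  let ?M = "{i\<in>?S Keep. src (\<sigma> ! i) < v}"
  let ?I = "\<lambda>R. {i\<in>?S Keep. src (\<sigma> ! i) = v \<and> R = sy (\<sigma> ! i)}"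
  have sk: "\<exists>\<rho>. path \<sigma> i = Some \<rho> \<and> src (\<sigma> ! i) \<le> v \<and> v < dst (\<sigma> ! i) \<and>
      wait_from (src (\<sigma> ! i)) (row0 n (\<sigma> ! i)) (exit_row \<sigma> i \<rho>) v \<le> ?h \<and> ?h < exit_row \<sigma> i \<rho> v"
    if "i \<in> ?S Keep" for i
  proof -
    have "path \<sigma> i \<noteq> None" using that by (auto simp: routing_def split: option.splits if_splits)
    then obtain \<rho> where p: "path \<sigma> i = Some \<rho>" by blast
    then show ?thesis using that sketched_packet(2)[OF p, of \<tau> v] by auto
  qed
  have "i = j" if ij: "i \<in> ?M" "j \<in> ?M" for i j
  proof -
    obtain \<rho> where i: "path \<sigma> i = Some \<rho>" "v < dst (\<sigma> ! i)" 
      "wait_from (src (\<sigma> ! i)) (row0 n (\<sigma> ! i)) (exit_row \<sigma> i \<rho>) v \<le> ?h" "?h < exit_row \<sigma> i \<rho> v"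
      using sk[of i] ij by blast
    obtain \<rho>' where j: "path \<sigma> j = Some \<rho>'" "v < dst (\<sigma> ! j)" 
      "wait_from (src (\<sigma> ! j)) (row0 n (\<sigma> ! j)) (exit_row \<sigma> j \<rho>') v \<le> ?h" "?h < exit_row \<sigma> j \<rho>' v"
      using sk[of j] ij by blast
    have "src (\<sigma> ! i) < v" "src (\<sigma> ! j) < v" using ij by auto
    then show ?thesis using waiting_inj[OF i(1) j(1)] i j by (simp add: wait_from_def)
  qed
  then have M: "card ?M \<le> Suc 0" by (rule card_le_Suc0I)
  have I: "card (?I R) \<le> Suc 0" for R
  proof -
    have "i = j" if ij: "i \<in> ?I R" "j \<in> ?I R" for i j
    proof -
      have S: "i \<in> ?S Keep" "j \<in> ?S Keep" using ij by auto
      obtain \<rho> where p: "path \<sigma> i = Some \<rho>" using sk[OF S(1)] by blast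
      obtain \<rho>' where p': "path \<sigma> j = Some \<rho>'" using sk[OF S(2)] by blast
      have "src (\<sigma> ! i) = v" "src (\<sigma> ! j) = v" "R = sy (\<sigma> ! i)" "R = sy (\<sigma> ! j)" using ij by blast+
      then have "sx (\<sigma> ! i) = sx (\<sigma> ! j)" "sy (\<sigma> ! i) = sy (\<sigma> ! j)" by (simp add: sx_def, metis)
      then show ?thesis by (rule start_tile_inj[OF p p'])
    qed
    then show ?thesis by (rule card_le_Suc0I)
  qed
  have "?S Keep \<subseteq> ?M \<union> (?I (?h div K) \<union> ?I (?h div K - 1))"
  proof
    fix i assume i: "i \<in> ?S Keep"
    obtain \<rho> where p: "path \<sigma> i = Some \<rho>" "src (\<sigma> ! i) \<le> v"
      "wait_from (src (\<sigma> ! i)) (row0 n (\<sigma> ! i)) (exit_row \<sigma> i \<rho>) v \<le> ?h" "?h < exit_row \<sigma> i \<rho> v"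
      using sk[OF i] by blast
    show "i \<in> ?M \<union> (?I (?h div K) \<union> ?I (?h div K - 1))"
    proof (cases "src (\<sigma> ! i) = v")
      case True
      then have "sy (\<sigma> ! i) = ?h div K \<or> Suc (sy (\<sigma> ! i)) = ?h div K"
        using exit_row_src(2)[OF p(1), of ?h] p by (simp add: wait_from_def)
      then have "sy (\<sigma> ! i) = ?h div K \<or> sy (\<sigma> ! i) = ?h div K - 1" by linarith
      then show ?thesis using i True by auto
    next
      case False
      then have "src (\<sigma> ! i) < v" using p(2) by simp
      then show ?thesis using i by blast
    qed
  qed
  then have "card (?S Keep) \<le> card (?M \<union> (?I (?h div K) \<union> ?I (?h div K - 1)))"
    by (intro card_mono) auto
  also have "\<dots> \<le> card ?M + (card (?I (?h div K)) + card (?I (?h div K - 1)))"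
    by (intro order_trans[OF card_Un_le] add_mono card_Un_le order_refl)
  also have "\<dots> \<le> B" using M I[of "?h div K"] I[of "?h div K - 1"] assms(2) by linarith
  finally show "card (?S Keep) \<le> B" .
qed

end

end

section \<open>Competitive ratio\<close>

context line_grid
begin

lemma in_time_mono: "in_time r R \<Longrightarrow> R' \<le> R \<Longrightarrow> in_time r R'"
proof -
  assume "in_time r R" "R' \<le> R"
  then have "enat (R' * K + K - 1 + dst r) \<le> enat (R * K + K - 1 + dst r)"
    by (simp add: diff_le_mono mult_le_mono1)
  also have "\<dots> \<le> ddl r + enat n" using \<open>in_time r R\<close> by (simp add: in_time_def)
  finally show ?thesis by (simp add: in_time_def)
qed

context
  fixes \<sigma> :: "request list" and c B :: nat and I :: "nat set" and Y :: "nat \<Rightarrow> nat \<Rightarrow> nat"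
  assumes valid: "valid_input n \<sigma>"
    and I: "I \<subseteq> {..<length \<sigma>}"
    and ps: "path_system c B I (\<lambda>i. src (\<sigma> ! i)) (\<lambda>i. dst (\<sigma> ! i)) (\<lambda>i. row0 n (\<sigma> ! i)) Y"
    and ddl: "\<And>i. i \<in> I \<Longrightarrow> src (\<sigma> ! i) < dst (\<sigma> ! i) \<Longrightarrow>
       enat (Y i (dst (\<sigma> ! i) - 1) + dst (\<sigma> ! i)) \<le> ddl (\<sigma> ! i) + enat n"
begin

definition delivered_set where
  "delivered_set = {i. i < length \<sigma> \<and> delivered \<sigma> (routing \<sigma>) i}"

lemma finite_delivered_set: "finite delivered_set" by (simp add: delivered_set_def)

lemma far_bound: "card {i\<in>I. far (\<sigma> ! i)} \<le> (1 + 12 * (K * (c + B))) * card delivered_set"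
proof -
  let ?J = "{i\<in>I. far (\<sigma> ! i)}"
  let ?a = "\<lambda>i. src (\<sigma> ! i)" and ?b = "\<lambda>i. dst (\<sigma> ! i)" and ?y = "\<lambda>i. row0 n (\<sigma> ! i)"
  let ?last = "\<lambda>i. Y i ((dx (\<sigma> ! i) - 1) * K + K - 1) div K"
  \<comment> \<open>The tile row of the last full column may extend beyond the deadline. The tile
    row below lies entirely under the row in which the packet was actually delivered, so it is in
    time.\<close>
  define U where "U i = (if in_time (\<sigma> ! i) (?last i) then ?last i else ?last i - 1)" for i
  have psJ: "path_system c B ?J ?a ?b ?y Y" using ps by (rule path_system_subset) auto
  interpret T: tiled_trajectories c B ?J ?a ?b ?y Y n K U
    by standard (use psJ K_pos in \<open>auto simp: far_def sx_def dx_def\<close>)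
  have U: "U i = ?last i \<and> in_time (\<sigma> ! i) (?last i) \<or>
      Suc (U i) = ?last i \<and> Suc (sy (\<sigma> ! i)) \<le> U i" if "i \<in> ?J" for i
  proof (cases "in_time (\<sigma> ! i) (?last i)")
    case False
    then have "Suc (sy (\<sigma> ! i)) < ?last i"
      using that in_time_mono[of "\<sigma> ! i" "Suc (sy (\<sigma> ! i))" "?last i"] by (force simp: far_def)
    then show ?thesis using False by (auto simp: U_def)
  qed (simp add: U_def)
  have late: "in_time (\<sigma> ! i) (U i)" if i: "i \<in> ?J" for i
  proof (cases "in_time (\<sigma> ! i) (?last i)")
    case False
    let ?r = "\<sigma> ! i"
    have l: "0 < ?last i" "U i = ?last i - 1" using U[OF i] False by auto
    have d: "sx ?r \<le> dx ?r - 1" "dx ?r - 1 < dx ?r" using i by (auto simp: far_def)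
    have e: "?a i \<le> (dx ?r - 1) * K + K - 1" "(dx ?r - 1) * K + K - 1 < ?b i"
      using T.edge_in[OF i, of "dx ?r - 1"] d by (simp_all add: sx_def dx_def)
    have "(?last i - 1) * K + K = ?last i * K" using l(1) by (cases "?last i") auto
    also have "\<dots> \<le> Y i ((dx ?r - 1) * K + K - 1)" by (rule tile_bounds(1)[OF K_pos])
    also have "\<dots> \<le> Y i (?b i - 1)" using e by (intro T.Y_mono[OF i]) auto
    finally have "enat ((?last i - 1) * K + K - 1 + ?b i) \<le> enat (Y i (?b i - 1) + ?b i)" by simp
    also have "\<dots> \<le> ddl ?r + enat n" using i e by (intro ddl) auto
    finally show ?thesis using l(2) by (simp add: in_time_def)
  qed (simp add: U_def)
  have \<rho>: "T.\<rho> i (dx (\<sigma> ! i) - 1) = ?last i" for i by (simp add: T.\<rho>_def)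
  have sk: "sketch (\<sigma> ! i) (T.\<rho>' i)" if i: "i \<in> ?J" for i
    unfolding sketch_def
  proof (intro conjI allI impI)
    let ?r = "\<sigma> ! i"
    have d: "sx ?r < dx ?r - 1" "dx ?r - 1 < dx ?r" using i by (auto simp: far_def)
    show "T.\<rho>' i X \<le> T.\<rho>' i X'" if "sx ?r \<le> X \<and> X \<le> X' \<and> X' < dx ?r" for X X'
      using that T.\<rho>'_mono[OF i] by (simp add: sx_def dx_def)
    show "T.\<rho>' i (sx ?r) = Suc (sy ?r)" by (simp add: T.\<rho>'_def sx_def sy_def)
    show "T.\<rho>' i (dx ?r - 1) \<le> Suc (sy ?r) + 2 * n"
      using T.\<rho>'_top[OF i, of "dx ?r - 1"] d by (simp add: sx_def dx_def sy_def)
    have "T.\<rho>' i (dx ?r - 1) \<le> max (Suc (sy ?r)) (U i)"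
      using d(1) by (auto simp: T.\<rho>'_def sx_def sy_def)
    moreover have "in_time ?r (max (Suc (sy ?r)) (U i))"
      using late[OF i] i by (simp add: max_def far_def)
    ultimately show "in_time ?r (T.\<rho>' i (dx ?r - 1))" using in_time_mono by blast
  qed
  let ?F = "{i\<in>?J. path \<sigma> i = None}" and ?A = "{j\<in>{..<length \<sigma>}. path \<sigma> j \<noteq> None}"
  have finF: "finite ?F" by (rule finite_subset[OF _ T.finite_I]) auto
  have "card ?F \<le> 3 * (4 * (K * (c + B))) * card ?A"
  proof (rule packing_competitive[where \<rho> = "T.\<rho>'"])
    show "finite ?F" by (rule finF)
    show "i < length \<sigma> \<and> far (\<sigma> ! i) \<and> path \<sigma> i = None \<and> sketch (\<sigma> ! i) (T.\<rho>' i)" if "i \<in> ?F" for i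
      using that sk I by auto
  next
    fix X R
    have "card {i\<in>?F. sx (\<sigma> ! i) = X \<and> sy (\<sigma> ! i) = R} \<le> card {i\<in>?J. ?a i div K = X \<and> ?y i div K = R}"
      by (intro card_mono finite_subset[OF _ T.finite_I]) (auto simp: sx_def sy_def)
    also have "\<dots> \<le> K * (c + B)" by (rule T.source_tile_le)
    finally show "card {i\<in>?F. sx (\<sigma> ! i) = X \<and> sy (\<sigma> ! i) = R} \<le> 4 * (K * (c + B))" by simp
  next
    fix k :: key
    obtain d R l q where k: "k = (d, R, l, q)" by (cases k)
    show "card {i\<in>?F. k \<in> keys (\<sigma> ! i) (T.\<rho>' i)} \<le> 4 * (K * (c + B))"
    proof (cases d)
      case True
      let ?X = "q * 2 ^ l"
      have "{i\<in>?F. k \<in> keys (\<sigma> ! i) (T.\<rho>' i)} \<subseteq> {i\<in>?J. ?a i div K \<le> ?X \<and> ?X < ?b i div K \<and> T.\<rho>' i ?X = R}"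
      proof
        fix i assume "i \<in> {i\<in>?F. k \<in> keys (\<sigma> ! i) (T.\<rho>' i)}"
        then have i: "i \<in> ?J" "(True, R, l, q) \<in> keys (\<sigma> ! i) (T.\<rho>' i)" using k True by auto
        show "i \<in> {i\<in>?J. ?a i div K \<le> ?X \<and> ?X < ?b i div K \<and> T.\<rho>' i ?X = R}"
          using hkey_in_keysD[OF sk[OF i(1)] i(2)] i(1) by (simp add: sx_def dx_def)
      qed
      then have "card {i\<in>?F. k \<in> keys (\<sigma> ! i) (T.\<rho>' i)} \<le>
          card {i\<in>?J. ?a i div K \<le> ?X \<and> ?X < ?b i div K \<and> T.\<rho>' i ?X = R}"
        by (rule card_mono[rotated]) (rule finite_subset[OF _ T.finite_I], auto)
      also have "\<dots> \<le> 4 * (K * (c + B))"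
      proof (rule T.row_load_le)
        fix i assume i: "i \<in> ?J"
        show "U i = T.\<rho> i (?b i div K - 1) \<or> Suc (U i) = T.\<rho> i (?b i div K - 1) \<and> Suc (?y i div K) \<le> U i"
          using U[OF i] \<rho>[of i] unfolding dx_def sy_def by argo
      qed
      finally show ?thesis .
    next
      case False
      let ?R = "q * 2 ^ l"
      have "{i\<in>?F. k \<in> keys (\<sigma> ! i) (T.\<rho>' i)} \<subseteq>
        {i\<in>?J. ?a i div K < R \<and> R < ?b i div K \<and> T.\<rho>' i (R - 1) \<le> ?R \<and> ?R < T.\<rho>' i R}"
      proof
        fix i assume "i \<in> {i\<in>?F. k \<in> keys (\<sigma> ! i) (T.\<rho>' i)}"
        then have i: "i \<in> ?J" "(False, R, l, q) \<in> keys (\<sigma> ! i) (T.\<rho>' i)" using k False by auto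
        show "i \<in> {i\<in>?J. ?a i div K < R \<and> R < ?b i div K \<and> T.\<rho>' i (R - 1) \<le> ?R \<and> ?R < T.\<rho>' i R}"
          using vkey_in_keysD[OF i(2)] i(1) by (simp add: sx_def dx_def)
      qed
      then have "card {i\<in>?F. k \<in> keys (\<sigma> ! i) (T.\<rho>' i)} \<le>
          card {i\<in>?J. ?a i div K < R \<and> R < ?b i div K \<and> T.\<rho>' i (R - 1) \<le> ?R \<and> ?R < T.\<rho>' i R}"
        by (rule card_mono[rotated]) (rule finite_subset[OF _ T.finite_I], auto)
      also have "\<dots> \<le> 4 * (K * (c + B))" by (rule T.column_load_le)
      finally show ?thesis .
    qed
  qed
  also have "card ?A \<le> card delivered_set"
    using sketched_packet(1)[OF valid] finite_delivered_set by (intro card_mono) (auto simp: delivered_set_def)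
  finally have F: "card ?F \<le> 12 * (K * (c + B)) * card delivered_set" by simp
  have "?J \<subseteq> ?F \<union> delivered_set"
  proof
    fix i assume i: "i \<in> ?J"
    then have "i < length \<sigma>" using I by auto
    then show "i \<in> ?F \<union> delivered_set"
      using i sketched_packet(1)[OF valid, of i] by (cases "path \<sigma> i") (auto simp: delivered_set_def)
  qed
  then have "card ?J \<le> card (?F \<union> delivered_set)" using finF finite_delivered_set by (intro card_mono) auto
  also have "\<dots> \<le> card ?F + card delivered_set" by (rule card_Un_le)
  finally show ?thesis using F by (simp add: algebra_simps)
qed

text \<open>Each near packet is charged to a delivered row winner \<open>d\<close> and crosses the
  edge before the destination of \<open>d\<close>. Either it has length at most
  \<open>2 * K\<close>, or its small slack forces it over that edge within \<open>2 * K\<close>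
  rows; this gives \<open>2 * K * (c + B)\<close> and \<open>2 * K * c\<close>.\<close>

lemma near_bound:
  "card {i\<in>I. \<not> far (\<sigma> ! i) \<and> src (\<sigma> ! i) < dst (\<sigma> ! i)} \<le> 4 * (K * (c + B)) * card delivered_set"
proof -
  let ?J = "{i\<in>I. \<not> far (\<sigma> ! i) \<and> src (\<sigma> ! i) < dst (\<sigma> ! i)}"
  let ?a = "\<lambda>i. src (\<sigma> ! i)" and ?b = "\<lambda>i. dst (\<sigma> ! i)" and ?y = "\<lambda>i. row0 n (\<sigma> ! i)"
  interpret T: trajectories c B ?J ?a ?b ?y Y
    using path_system_subset[OF ps, of ?J] by unfold_locales auto
  have len: "i < length \<sigma>" if "i \<in> ?J" for i using that I by auto
  let ?N = "\<lambda>d. {i\<in>?J. ?y i = ?y d \<and> ?a i < ?b d \<and> ?b d \<le> ?b i}"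
  have "?J \<subseteq> (\<Union>d\<in>delivered_set. ?N d)"
  proof
    fix i assume i: "i \<in> ?J"
    \<comment> \<open>A trajectory never drops below its source row, so travelling straight is on
      time whenever the feasible routing is.\<close>
    have "row0 n (\<sigma> ! i) \<le> Y i (?b i - 1)" using T.y_le[OF i, of "?b i - 1"] i by auto
    then have "rel (\<sigma> ! i) + n + (?b i - ?a i) \<le> Y i (?b i - 1) + ?b i"
      using row0_eq[OF valid len[OF i]] i by simp
    then have "enat (rel (\<sigma> ! i) + n + (?b i - ?a i)) \<le> enat (Y i (?b i - 1) + ?b i)" by simp
    also have "\<dots> \<le> ddl (\<sigma> ! i) + enat n" using ddl i by simp
    finally have "enat (rel (\<sigma> ! i) + (?b i - ?a i)) \<le> ddl (\<sigma> ! i)" by (cases "ddl (\<sigma> ! i)") auto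
    then have "i \<in> entering \<sigma> (?y i) (?a i)" using i len[OF i] by (simp add: entering_def straight_def)
    then obtain d where d: "d \<in> entering \<sigma> (?y i) (?a d)"
      "\<And>z. ?a d \<le> z \<Longrightarrow> z < ?b d \<Longrightarrow> row_win \<sigma> (?y i) z = Some d" "?a i < ?b d" "?b d \<le> ?b i"
      using row_packing.packed_within[OF row_packing_entering[of \<sigma> "?y i"], of i] unfolding row_win_def by blast
    have "d \<in> delivered_set" using straight_delivered[OF valid d(1,2)] d(1) by (simp add: delivered_set_def entering_def)
    moreover have "?y d = ?y i" using d(1) by (simp add: entering_def)
    ultimately show "i \<in> (\<Union>d\<in>delivered_set. ?N d)" using i d(3,4) by fastforce
  qed
  then have "card ?J \<le> card (\<Union>d\<in>delivered_set. ?N d)"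
    by (intro card_mono finite_UN_I finite_delivered_set finite_subset[OF _ T.finite_I]) auto
  also have "\<dots> \<le> (\<Sum>d\<in>delivered_set. card (?N d))" using finite_delivered_set by (rule card_UN_le)
  also have "\<dots> \<le> (\<Sum>d\<in>delivered_set. 4 * (K * (c + B)))"
  proof (rule sum_mono)
    fix d
    let ?e = "?b d - 1" and ?u = "?y d div K * K"
    let ?S = "{i\<in>?J. ?y i = ?y d \<and> ?a i \<le> ?e \<and> ?e < ?b i \<and> ?b i \<le> ?a i + 2 * K}"
    let ?R = "{i\<in>?J. ?a i \<le> ?e \<and> ?e < ?b i \<and> ?u \<le> Y i ?e \<and> Y i ?e < ?u + 2 * K}"
    have "?N d \<subseteq> ?S \<union> ?R"
    proof
      fix i assume "i \<in> ?N d"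
      then have i: "i \<in> ?J" "?y i = ?y d" "?a i \<le> ?e" "?e < ?b i" by auto
      show "i \<in> ?S \<union> ?R"
      proof (cases "dx (\<sigma> ! i) \<le> Suc (sx (\<sigma> ! i))")
        case True
        have "?b i < dx (\<sigma> ! i) * K + K" unfolding dx_def using tile_bounds(2)[OF K_pos] .
        also have "\<dots> \<le> Suc (sx (\<sigma> ! i)) * K + K" using True by (intro add_right_mono mult_le_mono1)
        also have "\<dots> = sx (\<sigma> ! i) * K + 2 * K" by simp
        also have "\<dots> \<le> ?a i + 2 * K" unfolding sx_def using tile_bounds(1)[OF K_pos] by (intro add_right_mono)
        finally have "?b i \<le> ?a i + 2 * K" by simp
        then have "i \<in> ?S" using i by blast
        then show ?thesis ..
      next
        case False
        then have "\<not> in_time (\<sigma> ! i) (Suc (sy (\<sigma> ! i)))"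
          using i(1) bounds[OF valid len[OF i(1)]] by (simp add: far_def)
        then have "ddl (\<sigma> ! i) + enat n < enat (Suc (sy (\<sigma> ! i)) * K + K - 1 + ?b i)"
          by (simp only: in_time_def not_le)
        moreover have "enat (Y i (?b i - 1) + ?b i) \<le> ddl (\<sigma> ! i) + enat n" using ddl i(1) by simp
        ultimately have "enat (Y i (?b i - 1) + ?b i) < enat (Suc (sy (\<sigma> ! i)) * K + K - 1 + ?b i)"
          by (rule le_less_trans[rotated])
        then have "Y i (?b i - 1) < Suc (sy (\<sigma> ! i)) * K + K - 1" by simp
        moreover have "Y i ?e \<le> Y i (?b i - 1)" using i by (intro T.Y_mono) auto
        moreover have "?y i \<le> Y i ?e" using T.y_le[OF i(1,3,4)] .
        moreover have "?u \<le> ?y d" by (rule tile_bounds(1)[OF K_pos])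
        moreover have "Suc (sy (\<sigma> ! i)) * K = ?u + K" by (simp add: sy_def i(2))
        ultimately have "?u \<le> Y i ?e" "Y i ?e < ?u + 2 * K" using i(2) by linarith+
        then have "i \<in> ?R" using i by blast
        then show ?thesis ..
      qed
    qed
    then have "card (?N d) \<le> card (?S \<union> ?R)"
      by (rule card_mono[rotated]) (rule finite_subset[OF _ T.finite_I], auto)
    also have "\<dots> \<le> card ?S + card ?R" by (rule card_Un_le)
    also have "\<dots> \<le> 2 * K * (c + B) + 2 * K * c" by (intro add_mono T.short_le T.forward_block_le)
    also have "\<dots> \<le> 4 * (K * (c + B))" by (simp add: algebra_simps)
    finally show "card (?N d) \<le> 4 * (K * (c + B))" .
  qed
  finally show ?thesis by (simp add: mult.commute)
qed

end

lemma routing_competitive: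
  assumes valid: "valid_input n \<sigma>" and A: "feasible c B \<sigma> A" and "1 \<le> c"
  shows "throughput \<sigma> A \<le> 18 * (K * (c + B)) * throughput \<sigma> (routing \<sigma>)"
proof -
  let ?I = "{i. i < length \<sigma> \<and> delivered \<sigma> A i}" and ?P = "{i. i < length \<sigma> \<and> delivered \<sigma> (routing \<sigma>) i}"
  obtain Y where Y: "path_system c B ?I (\<lambda>i. src (\<sigma> ! i)) (\<lambda>i. dst (\<sigma> ! i)) (\<lambda>i. row0 n (\<sigma> ! i)) Y"
    "\<And>i. i < length \<sigma> \<Longrightarrow> delivered \<sigma> A i \<Longrightarrow> src (\<sigma> ! i) < dst (\<sigma> ! i) \<Longrightarrow>
       enat (Y i (dst (\<sigma> ! i) - 1) + dst (\<sigma> ! i)) \<le> ddl (\<sigma> ! i) + enat n"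
    using feasible_path_system[OF valid A] by blast
  have sub: "?I \<subseteq> {..<length \<sigma>}" by auto
  have D: "delivered_set \<sigma> = ?P" using delivered_set_def[OF valid sub Y(1)] Y(2) by blast
  let ?J = "{i\<in>?I. far (\<sigma> ! i)}" and ?N = "{i\<in>?I. \<not> far (\<sigma> ! i) \<and> src (\<sigma> ! i) < dst (\<sigma> ! i)}"
  have J: "card ?J \<le> (1 + 12 * (K * (c + B))) * card ?P"
    using far_bound[OF valid sub Y(1)] Y(2) D by auto
  have N: "card ?N \<le> 4 * (K * (c + B)) * card ?P"
    using near_bound[OF valid sub Y(1)] Y(2) D by auto
  have "?I \<subseteq> ?J \<union> ?N \<union> ?P"
  proof
    fix i assume i: "i \<in> ?I"
    show "i \<in> ?J \<union> ?N \<union> ?P"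
    proof (cases "src (\<sigma> ! i) < dst (\<sigma> ! i)")
      case False
      then have eq: "src (\<sigma> ! i) = dst (\<sigma> ! i)" using bounds[OF valid, of i] i by simp
      obtain \<tau> where \<tau>: "loc \<sigma> A i \<tau> = Some (dst (\<sigma> ! i))" "enat \<tau> \<le> ddl (\<sigma> ! i)"
        using i by (auto simp: delivered_def)
      have "enat (rel (\<sigma> ! i)) \<le> ddl (\<sigma> ! i)"
        using loc_rel_le[OF \<tau>(1)] \<tau>(2) by (meson enat_ord_simps(1) order_trans)
      \<comment> \<open>A packet input at its own destination is delivered on release, whatever the
        actions are.\<close>
      then have "delivered \<sigma> (routing \<sigma>) i" using loc_rel[of \<sigma> "routing \<sigma>" i] eq by (auto simp: delivered_def)
      then show ?thesis using i by simp
    qed (use i in auto)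
  qed
  then have "card ?I \<le> card (?J \<union> ?N \<union> ?P)" by (intro card_mono) auto
  also have "\<dots> \<le> card ?J + card ?N + card ?P" by (intro order_trans[OF card_Un_le] add_mono card_Un_le order_refl)
  also have "\<dots> \<le> (2 + 16 * (K * (c + B))) * card ?P" using J N by (simp add: algebra_simps)
  also have "\<dots> \<le> 18 * (K * (c + B)) * card ?P"
  proof (rule mult_le_mono1)
    have "1 \<le> K * (c + B)" using K_pos assms(3) by simp
    then show "2 + 16 * (K * (c + B)) \<le> 18 * (K * (c + B))" by linarith
  qed
  finally show ?thesis by (simp add: throughput_def)
qed

theorem online_routing_competitive:
  assumes valid: "valid_input n \<sigma>" and "3 \<le> c" "3 \<le> B"
  shows "feasible c B \<sigma> (online_routing \<sigma>)"
    and "opt c B \<sigma> \<le> 18 * (K * (c + B)) * throughput \<sigma> (online_routing \<sigma>)"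
proof -
  have eq: "routing \<sigma> i \<theta> = online_routing \<sigma> i \<theta>" if "i < length \<sigma>" "rel (\<sigma> ! i) \<le> \<theta>" for i \<theta>
    using routing_revealed[OF valid that] by (simp add: online_routing_def)
  have f: "feasible c B \<sigma> (routing \<sigma>)" using routing_feasible[OF valid] assms(2,3) .
  then show "feasible c B \<sigma> (online_routing \<sigma>)" using feasible_cong[of \<sigma> "routing \<sigma>" "online_routing \<sigma>"] eq by blast
  have "throughput \<sigma> (routing \<sigma>) = throughput \<sigma> (online_routing \<sigma>)" using eq by (rule throughput_cong)
  then show "opt c B \<sigma> \<le> 18 * (K * (c + B)) * throughput \<sigma> (online_routing \<sigma>)"
    using opt_le[OF f] routing_competitive[OF valid] assms(2) by simp
qed

end

theorem theorem5p1:
  "\<exists>C>0. \<forall>n B c. n \<ge> 2 \<longrightarrow>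
      3 \<le> real B \<longrightarrow> real B \<le> log 2 (real n) \<longrightarrow>
      3 \<le> real c \<longrightarrow> real c \<le> log 2 (real n) \<longrightarrow>
      (\<exists>alg :: algorithm. online n alg \<and>
         (\<forall>\<sigma>. valid_input n \<sigma> \<longrightarrow>
            feasible c B \<sigma> (alg \<sigma>) \<and>
            real (opt c B \<sigma>) \<le> C * (log 2 (real n)) ^ 5 * real (throughput \<sigma> (alg \<sigma>))))"
\<comment> \<open>\<open>576 = 18 * 16 * 2\<close>: the routing loses
  \<open>18 * K * (c + B)\<close>, with \<open>K\<close> at most 16 times the squared logarithm and
  \<open>c + B\<close> at most twice the logarithm. This cubic bound is then relaxed to the fifth
  power.\<close>
proof (intro exI[of _ "576 :: real"] conjI allI impI)
  fix n B c :: nat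
  assume n: "n \<ge> 2" and B: "3 \<le> real B" "real B \<le> log 2 (real n)" and c: "3 \<le> real c" "real c \<le> log 2 (real n)"
  \<comment> \<open>From \<open>n < 2 ^ (floor_log n + 1)\<close> one more doubling yields
    \<open>2 * n < 2 ^ L\<close>; the added 2 is absorbed since the logarithm is at least 3.\<close>
  let ?L = "floor_log n + 2" let ?K = "4 * ?L * ?L" let ?l = "log 2 (real n)"
  interpret line_grid n ?L ?K
    using n floor_log_exp2_gt[of n] by unfold_locales auto
  have l: "3 \<le> ?l" using B by linarith
  have "real (2 ^ floor_log n) \<le> real n" using n floor_log_exp2_le[of n] by (intro of_nat_mono) simp
  then have "real (floor_log n) \<le> ?l" by (intro le_log_of_power) simp_all
  then have L: "real ?L \<le> 2 * ?l" using l by simp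
  have "real ?K = 4 * (real ?L * real ?L)" by (simp only: of_nat_mult of_nat_numeral mult.assoc)
  also have "\<dots> \<le> 4 * ((2 * ?l) * (2 * ?l))" using L l by (intro mult_left_mono mult_mono) auto
  finally have K: "real ?K \<le> 16 * ?l ^ 2" by (simp add: power2_eq_square)
  have "real (18 * (?K * (c + B))) = 18 * (real ?K * (real c + real B))" by simp
  also have "\<dots> \<le> 18 * ((16 * ?l ^ 2) * (2 * ?l))" using K B c l by (intro mult_left_mono mult_mono) auto
  also have "\<dots> = 576 * ?l ^ 3" by (simp add: power2_eq_square power3_eq_cube)
  also have "\<dots> \<le> 576 * ?l ^ 5" using l by (intro mult_left_mono power_increasing) auto
  finally have M: "real (18 * (?K * (c + B))) \<le> 576 * ?l ^ 5" .
  show "\<exists>alg :: algorithm. online n alg \<and> (\<forall>\<sigma>. valid_input n \<sigma> \<longrightarrow> feasible c B \<sigma> (alg \<sigma>) \<and>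
    real (opt c B \<sigma>) \<le> 576 * ?l ^ 5 * real (throughput \<sigma> (alg \<sigma>)))"
  proof (intro exI[of _ online_routing] conjI allI impI)
    show "online n online_routing" by (rule online_online_routing)
    fix \<sigma> assume v: "valid_input n \<sigma>"
    have cB: "3 \<le> c" "3 \<le> B" using B(1) c(1) by simp_all
    show "feasible c B \<sigma> (online_routing \<sigma>)" by (rule online_routing_competitive(1)[OF v cB])
    have "real (opt c B \<sigma>) \<le> real (18 * (?K * (c + B)) * throughput \<sigma> (online_routing \<sigma>))"
      using online_routing_competitive(2)[OF v cB] by (intro of_nat_mono)
    also have "\<dots> = real (18 * (?K * (c + B))) * real (throughput \<sigma> (online_routing \<sigma>))" by (rule of_nat_mult)
    also have "\<dots> \<le> 576 * ?l ^ 5 * real (throughput \<sigma> (online_routing \<sigma>))"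
      using M by (intro mult_right_mono) auto
    finally show "real (opt c B \<sigma>) \<le> 576 * ?l ^ 5 * real (throughput \<sigma> (online_routing \<sigma>))" .
  qed
qed simp

end
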